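(* Let $\phi$ be a Drinfeld $A[\underline{t}_s]$-module over $\mathbb{T}_s$ with $\phi_\theta=\theta+A_1\tau+\dots+A_r\tau^r$, $A_r\in\mathbb{T}_s^\times$. If $\phi$ has a rigid analytic trivialization, then $\phi$ is uniformizable, i.e. $\exp_\phi:\mathbb{T}_s\to\mathbb{T}_s$ is surjective.
   Context: $\mathbb{F}_q$ finite field, $\theta,t_1,\dots,t_s,z$ independent variables, $A[\underline{t}_s]=\mathbb{F}_q[\theta,t_1,\dots,t_s]$, $\mathbb{F}_q[\underline{t}_s]=\mathbb{F}_q[t_1,\dots,t_s]$. $\mathbb{C}_\infty$: completion of an algebraic closure of $\mathbb{F}_q((1/\theta))$, $|\theta|_\infty=q$. $\mathbb{T}_s$: Tate algebra of power series in $t_1,\dots,t_s$ over $\mathbb{C}_\infty$ with coefficients tending to $0$, Gauss norm $\|\cdot\|_\infty$. $\tau$: automorphism raising $\mathbb{C}_\infty$-coefficients to the $q$-th power, $f^{(n)}=\tau^n(f)$ ($n\in\mathbb{Z}$), applied entrywise to matrices and coefficientwise to power series in $z$. $\mathbb{T}_s[\tau]$, $\mathbb{T}_s[[\tau]]$: twisted rings with $\tau f=f^{(1)}\tau$, acting by $\sum a_i\tau^i(f)=\sum a_if^{(i)}$. A Drinfeld $A[\underline{t}_s]$-module is an $\mathbb{F}_q[\underline{t}_s]$-algebra homomorphism $\phi:A[\underline{t}_s]\to\mathbb{T}_s[\tau]$ with $\phi_\theta=\theta+A_1\tau+\dots+A_r\tau^r$; $\exp_\phi=\sum\alpha_i\tau^i$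 is the unique series with $\alpha_0=1$, $\exp_\phi a=\phi_a\exp_\phi$, converging on $\mathbb{T}_s$. $\mathbb{T}_s\{z/\theta\}=\{\sum_{i\ge0}a_iz^i: a_i\in\mathbb{T}_s,\ q^i\|a_i\|_\infty\to0\}$. $\Phi\in\mathrm{Mat}_r(\mathbb{T}_s[z])$ has $i$-th row the $(i+1)$-st standard basis row vector for $1\le i\le r-1$ and last row $\big[(z-\theta)/A_r^{(-r)},-A_1^{(-1)}/A_r^{(-r)},\dots,-A_{r-1}^{(-r+1)}/A_r^{(-r)}\big]$. A rigid analytic trivialization of $\phi$ is a $\Psi\in\mathrm{GL}_r(\mathbb{T}_s\{z/\theta\})$ with $\Psi^{(-1)}=\Phi\Psi$. *)

theory Defs
  imports Complex_Main "HOL-Computational_Algebra.Polynomial"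
begin

text \<open>The field 'k together with the absolute value av plays the role of C_infinity.
  q is the cardinality of the finite field F_q, theta is the variable theta.
  F_q is the set of roots of x^q - x in 'k.\<close>

definition Fq :: "nat \<Rightarrow> 'k::field set" where
  "Fq q = {x. x ^ q = x}"

definition Fq_theta :: "nat \<Rightarrow> 'k::field \<Rightarrow> 'k set" where
  "Fq_theta q th = {poly a th / poly b th | a b.
      set (coeffs a) \<subseteq> Fq q \<and> set (coeffs b) \<subseteq> Fq q \<and> b \<noteq> 0}"

definition K_inf :: "('k::field \<Rightarrow> real) \<Rightarrow> nat \<Rightarrow> 'k \<Rightarrow> 'k set" where
  "K_inf av q th = {x. \<forall>e>0. \<exists>y\<in>Fq_theta q th. av (x - y) < e}"

definition C_infty_field :: "('k::field \<Rightarrow> real) \<Rightarrow> nat \<Rightarrow> nat \<Rightarrow> 'k \<Rightarrow> bool" where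
  "C_infty_field av p q th \<longleftrightarrow>
     prime p \<and> CHAR('k) = p \<and> (\<exists>e>0. q = p ^ e) \<and>
     av 0 = 0 \<and> (\<forall>x. x \<noteq> 0 \<longrightarrow> av x > 0) \<and>
     (\<forall>x y. av (x * y) = av x * av y) \<and>
     (\<forall>x y. av (x + y) \<le> max (av x) (av y)) \<and>
     (\<forall>X::nat \<Rightarrow> 'k. (\<forall>e>0. \<exists>N. \<forall>m\<ge>N. \<forall>n\<ge>N. av (X m - X n) < e) \<longrightarrow>
         (\<exists>L. (\<lambda>n. av (X n - L)) \<longlonglongrightarrow> 0)) \<and>
     (\<forall>P::'k poly. degree P > 0 \<longrightarrow> (\<exists>x. poly P x = 0)) \<and>
     av th = real q \<and>
     (\<forall>x. \<forall>e>0. \<exists>y. av (x - y) < e \<and>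
         (\<exists>P::'k poly. P \<noteq> 0 \<and> set (coeffs P) \<subseteq> K_inf av q th \<and> poly P y = 0))"

definition frobk :: "nat \<Rightarrow> int \<Rightarrow> 'k::field \<Rightarrow> 'k" where
  "frobk q n x = (if n \<ge> 0 then x ^ (q ^ nat n) else (THE y. y ^ (q ^ nat (- n)) = x))"

text \<open>An element of T_s is represented by its coefficient function on exponent vectors
  nu :: nat \<Rightarrow> nat (the coefficient of t_1^(nu 0) ... t_s^(nu (s-1))).\<close>

type_synonym 'k tate = "(nat \<Rightarrow> nat) \<Rightarrow> 'k"

definition tate :: "('k::field \<Rightarrow> real) \<Rightarrow> nat \<Rightarrow> 'k tate \<Rightarrow> bool" where
  "tate av s f \<longleftrightarrow> (\<forall>\<nu>. (\<exists>j\<ge>s. \<nu> j \<noteq> 0) \<longrightarrow> f \<nu> = 0) \<and>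
                    (\<forall>e>0. finite {\<nu>. av (f \<nu>) \<ge> e})"

definition tzero :: "'k::field tate" where "tzero = (\<lambda>_. 0)"
definition tone :: "'k::field tate" where "tone = (\<lambda>\<nu>. if \<nu> = (\<lambda>_. 0) then 1 else 0)"
definition tconst :: "'k::field \<Rightarrow> 'k tate" where "tconst c = (\<lambda>\<nu>. if \<nu> = (\<lambda>_. 0) then c else 0)"

definition tmul :: "'k::field tate \<Rightarrow> 'k tate \<Rightarrow> 'k tate" where
  "tmul f g = (\<lambda>\<nu>. \<Sum>\<mu>\<in>{\<mu>. \<mu> \<le> \<nu>}. f \<mu> * g (\<lambda>j. \<nu> j - \<mu> j))"

definition tunit :: "('k::field \<Rightarrow> real) \<Rightarrow> nat \<Rightarrow> 'k tate \<Rightarrow> bool" where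
  "tunit av s f \<longleftrightarrow> tate av s f \<and> (\<exists>g. tate av s g \<and> tmul f g = tone)"

definition tinv :: "('k::field \<Rightarrow> real) \<Rightarrow> nat \<Rightarrow> 'k tate \<Rightarrow> 'k tate" where
  "tinv av s f = (THE g. tate av s g \<and> tmul f g = tone)"

definition gnorm :: "('k::field \<Rightarrow> real) \<Rightarrow> 'k tate \<Rightarrow> real" where
  "gnorm av f = Sup (range (\<lambda>\<nu>. av (f \<nu>)))"

definition tfrob :: "nat \<Rightarrow> int \<Rightarrow> 'k::field tate \<Rightarrow> 'k tate" where
  "tfrob q n f = (\<lambda>\<nu>. frobk q n (f \<nu>))"

definition phi_coeff :: "'k::field \<Rightarrow> (nat \<Rightarrow> 'k tate) \<Rightarrow> nat \<Rightarrow> 'k tate" where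
  "phi_coeff th A j = (if j = 0 then tconst th else A j)"

text \<open>alpha is the coefficient sequence of exp_phi = sum alpha_i tau^i:
  alpha_0 = 1 and exp_phi theta = phi_theta exp_phi in T_s[[tau]].\<close>
definition is_exp_coeffs ::
  "('k::field \<Rightarrow> real) \<Rightarrow> nat \<Rightarrow> nat \<Rightarrow> 'k \<Rightarrow> nat \<Rightarrow> (nat \<Rightarrow> 'k tate) \<Rightarrow> (nat \<Rightarrow> 'k tate) \<Rightarrow> bool" where
  "is_exp_coeffs av q s th r A \<alpha> \<longleftrightarrow>
     (\<forall>i. tate av s (\<alpha> i)) \<and> \<alpha> 0 = tone \<and>
     (\<forall>n. tmul (\<alpha> n) (tconst (th ^ (q ^ n))) =
          (\<lambda>\<nu>. \<Sum>j\<in>{0..min n r}. tmul (phi_coeff th A j) (tfrob q (int j) (\<alpha> (n - j))) \<nu>))"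

definition exp_coeffs ::
  "('k::field \<Rightarrow> real) \<Rightarrow> nat \<Rightarrow> nat \<Rightarrow> 'k \<Rightarrow> nat \<Rightarrow> (nat \<Rightarrow> 'k tate) \<Rightarrow> nat \<Rightarrow> 'k tate" where
  "exp_coeffs av q s th r A = (THE \<alpha>. is_exp_coeffs av q s th r A \<alpha>)"

definition exp_converges_to ::
  "('k::field \<Rightarrow> real) \<Rightarrow> nat \<Rightarrow> (nat \<Rightarrow> 'k tate) \<Rightarrow> 'k tate \<Rightarrow> 'k tate \<Rightarrow> bool" where
  "exp_converges_to av q \<alpha> f g \<longleftrightarrow>
     (\<lambda>n. gnorm av (\<lambda>\<nu>. (\<Sum>i<n. tmul (\<alpha> i) (tfrob q (int i) f) \<nu>) - g \<nu>)) \<longlonglongrightarrow> 0"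

definition uniformizable ::
  "('k::field \<Rightarrow> real) \<Rightarrow> nat \<Rightarrow> nat \<Rightarrow> 'k \<Rightarrow> nat \<Rightarrow> (nat \<Rightarrow> 'k tate) \<Rightarrow> bool" where
  "uniformizable av q s th r A \<longleftrightarrow>
     (\<forall>g. tate av s g \<longrightarrow>
        (\<exists>f. tate av s f \<and> exp_converges_to av q (exp_coeffs av q s th r A) f g))"

type_synonym 'k zser = "nat \<Rightarrow> 'k tate"

definition zzero :: "'k::field zser" where "zzero = (\<lambda>_. tzero)"
definition zone :: "'k::field zser" where "zone = (\<lambda>n. if n = 0 then tone else tzero)"
definition zconst :: "'k::field tate \<Rightarrow> 'k zser" where "zconst c = (\<lambda>n. if n = 0 then c else tzero)"

definition zmul :: "'k::field zser \<Rightarrow> 'k zser \<Rightarrow> 'k zser" where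
  "zmul a b = (\<lambda>n \<nu>. \<Sum>m\<le>n. tmul (a m) (b (n - m)) \<nu>)"

definition Tz :: "('k::field \<Rightarrow> real) \<Rightarrow> nat \<Rightarrow> nat \<Rightarrow> 'k zser \<Rightarrow> bool" where
  "Tz av q s a \<longleftrightarrow> (\<forall>i. tate av s (a i)) \<and>
     (\<lambda>i. real q ^ i * gnorm av (a i)) \<longlonglongrightarrow> 0"

definition zfrob :: "nat \<Rightarrow> int \<Rightarrow> 'k::field zser \<Rightarrow> 'k zser" where
  "zfrob q n a = (\<lambda>i. tfrob q n (a i))"

text \<open>r x r matrices with z-series entries (only indices < r matter).\<close>
type_synonym 'k zmat = "nat \<Rightarrow> nat \<Rightarrow> 'k zser"

definition zmatmul :: "nat \<Rightarrow> 'k::field zmat \<Rightarrow> 'k zmat \<Rightarrow> 'k zmat" where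
  "zmatmul r M N = (\<lambda>i j n \<nu>. \<Sum>k<r. zmul (M i k) (N k j) n \<nu>)"

definition zid :: "'k::field zmat" where
  "zid = (\<lambda>i j. if i = j then zone else zzero)"

definition in_GL :: "('k::field \<Rightarrow> real) \<Rightarrow> nat \<Rightarrow> nat \<Rightarrow> nat \<Rightarrow> 'k zmat \<Rightarrow> bool" where
  "in_GL av q s r M \<longleftrightarrow> (\<forall>i<r. \<forall>j<r. Tz av q s (M i j)) \<and>
     (\<exists>N. (\<forall>i<r. \<forall>j<r. Tz av q s (N i j)) \<and>
          (\<forall>i<r. \<forall>j<r. zmatmul r M N i j = zid i j \<and> zmatmul r N M i j = zid i j))"

definition Phi_mat ::
  "('k::field \<Rightarrow> real) \<Rightarrow> nat \<Rightarrow> nat \<Rightarrow> 'k \<Rightarrow> nat \<Rightarrow> (nat \<Rightarrow> 'k tate) \<Rightarrow> 'k zmat" where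
  "Phi_mat av q s th r A = (\<lambda>i j.
     (let d = tinv av s (tfrob q (- int r) (A r)) in
      if i + 1 < r then (if j = i + 1 then zone else zzero)
      else if j = 0 then
        (\<lambda>n. if n = 0 then tmul (tconst (- th)) d else if n = 1 then d else tzero)
      else zconst (tmul (\<lambda>\<nu>. - tfrob q (- int j) (A j) \<nu>) d)))"

definition rigid_analytic_trivialization ::
  "('k::field \<Rightarrow> real) \<Rightarrow> nat \<Rightarrow> nat \<Rightarrow> 'k \<Rightarrow> nat \<Rightarrow> (nat \<Rightarrow> 'k tate) \<Rightarrow> 'k zmat \<Rightarrow> bool" where
  "rigid_analytic_trivialization av q s th r A \<Psi> \<longleftrightarrow>
     in_GL av q s r \<Psi> \<and>
     (\<forall>i<r. \<forall>j<r. zfrob q (-1) (\<Psi> i j) = zmatmul r (Phi_mat av q s th r A) \<Psi> i j)"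

end

theory Submission
  imports Defs "HOL-Computational_Algebra.Formal_Power_Series"
begin

text \<open>
  Let N be the inverse of the trivialization Psi and f in the Tate algebra. Since C-infinity is
  algebraically closed, the diagonal system u - u^(-1) = f e_1 Psi has a solution with
  coefficients tending to 0 (Artin--Schreier equations). Then y = u N satisfies
  y = y^(-1) Phi + f e_1, and unwinding the companion matrix Phi shows that
  g = y_r^(-1) / A_r^(-r) solves theta g + A_1 g^(1) + ... + A_r g^(r) = f + z g. Comparing
  coefficients of z gives phi_theta(g_0) = f, phi_theta(g_{n+1}) = g_n and g_n -> 0.
  For large n the element g_n lies in a neighbourhood of 0 on which the exponential is invertible,
  say g_n = exp(x), and therefore f = exp(theta^(n+1) x). The series at theta x converges
  whenever the one at x does, so no growth estimate beyond this neighbourhood is needed.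
\<close>

unbundle fps_syntax

section \<open>The ring of power series in arbitrarily many variables\<close>

text \<open>The data are raw coefficient functions, which form no ring as they stand. They are moved
  into two rings: \<open>mps\<close>, power series in countably many variables, and formal power
  series in z over \<open>mps\<close>. Membership in the Tate algebra and smallness stay predicates
  on \<open>mps\<close>, so the number s of variables never enters a type. Two estimates carry the
  analysis. An equation x - x^(-1) = c with |c| < 1 has a solution with |x| \<le> |c|; this is why
  the solution of the twisted system still has coefficients tending to 0. The coefficients of the
  exponential satisfy ||alpha_n|| \<le> M^(q^n - 1), where M \<ge> 1 bounds the coefficients of
  phi_theta; this gives the radius 1/(2M) of the ball on which exp differs from the identity by a
  contraction.\<close>

definition splits :: "(nat \<Rightarrow> nat) \<Rightarrow> ((nat \<Rightarrow> nat) \<times> (nat \<Rightarrow> nat)) set" where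
  "splits \<nu> = {(\<mu>, \<kappa>). \<forall>j. \<mu> j + \<kappa> j = \<nu> j}"

lemma finite_le_fun:
  fixes \<nu> :: "nat \<Rightarrow> nat"
  assumes "finite {j. \<nu> j \<noteq> 0}"
  shows "finite {\<mu>. \<mu> \<le> \<nu>}"
proof -
  define m where "m = Max (\<nu> ` {j. \<nu> j \<noteq> 0})"
  have le: "\<nu> j \<le> m" if "\<nu> j \<noteq> 0" for j
    unfolding m_def using assms that by (intro Max_ge) auto
  have "{\<mu>. \<mu> \<le> \<nu>} \<subseteq> {f. \<forall>x. (x \<in> {j. \<nu> j \<noteq> 0} \<longrightarrow> f x \<in> {..m}) \<and> (x \<notin> {j. \<nu> j \<noteq> 0} \<longrightarrow> f x = 0)}"
  proof (intro subsetI CollectI allI conjI impI)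
    fix \<mu> j assume "\<mu> \<in> {\<mu>. \<mu> \<le> \<nu>}"
    hence *: "\<mu> j \<le> \<nu> j" by (simp add: le_fun_def)
    show "\<mu> j \<in> {..m}" if "j \<in> {j. \<nu> j \<noteq> 0}" using le[of j] that * by simp
    show "\<mu> j = 0" if "j \<notin> {j. \<nu> j \<noteq> 0}" using that * by simp
  qed
  thus ?thesis
    by (rule finite_subset) (intro finite_set_of_finite_funs assms finite_atMost)
qed

lemma splits_eq_image: "splits \<nu> = (\<lambda>\<mu>. (\<mu>, \<lambda>j. \<nu> j - \<mu> j)) ` {\<mu>. \<mu> \<le> \<nu>}"
proof (intro set_eqI iffI)
  fix x assume "x \<in> splits \<nu>"
  then obtain a b where x: "x = (a, b)" "\<And>j. a j + b j = \<nu> j" by (auto simp: splits_def)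
  have "b = (\<lambda>j. \<nu> j - a j)" "a \<le> \<nu>" by (auto simp: le_fun_def simp flip: x(2))
  thus "x \<in> (\<lambda>\<mu>. (\<mu>, \<lambda>j. \<nu> j - \<mu> j)) ` {\<mu>. \<mu> \<le> \<nu>}" using x(1) by auto
qed (auto simp: splits_def le_fun_def)

lemma finite_splits: "finite {j. \<nu> j \<noteq> 0} \<Longrightarrow> finite (splits \<nu>)"
  unfolding splits_eq_image by (intro finite_imageI finite_le_fun)

lemma splits_finite_support:
  assumes "(a, b) \<in> splits \<nu>" "finite {j. \<nu> j \<noteq> 0}"
  shows "finite {j. a j \<noteq> 0}" "finite {j. b j \<noteq> 0}"
proof -
  have "\<nu> j = a j + b j" for j using assms(1) by (simp add: splits_def)
  hence "{j. a j \<noteq> 0} \<subseteq> {j. \<nu> j \<noteq> 0}" "{j. b j \<noteq> 0} \<subseteq> {j. \<nu> j \<noteq> 0}" by auto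
  thus "finite {j. a j \<noteq> 0}" "finite {j. b j \<noteq> 0}"
    using assms(2) finite_subset by blast+
qed

lemma splits_infinite_support:
  assumes "(a, b) \<in> splits \<nu>" "infinite {j. \<nu> j \<noteq> 0}"
  shows "infinite {j. a j \<noteq> 0} \<or> infinite {j. b j \<noteq> 0}"
proof -
  have "\<nu> j = a j + b j" for j using assms(1) by (simp add: splits_def)
  hence "{j. \<nu> j \<noteq> 0} \<subseteq> {j. a j \<noteq> 0} \<union> {j. b j \<noteq> 0}" by auto
  thus ?thesis using assms(2) by (meson finite_Un finite_subset)
qed

lemma tmul_splits: "tmul f g \<nu> = (\<Sum>(\<mu>, \<kappa>)\<in>splits \<nu>. f \<mu> * g \<kappa>)"
  unfolding splits_eq_image tmul_def by (subst sum.reindex) (auto simp: inj_on_def)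

text \<open>The set of all \<mu> \<le> \<nu>, over which \<open>tmul\<close> sums, is finite exactly
  when \<nu> has finite support. On functions vanishing at all other exponents \<open>tmul\<close>
  satisfies the ring laws. Tate elements are of this kind, since they involve only the first s
  variables.\<close>

typedef (overloaded) 'a mps =
  "{f :: (nat \<Rightarrow> nat) \<Rightarrow> 'a::zero. \<forall>\<nu>. infinite {j. \<nu> j \<noteq> 0} \<longrightarrow> f \<nu> = 0}"
  morphisms mcoeff Mps
  by (rule exI[of _ "\<lambda>_. 0"]) simp

lemma mps_eqI:
  assumes "\<And>\<nu>. finite {j. \<nu> j \<noteq> 0} \<Longrightarrow> mcoeff f \<nu> = mcoeff g \<nu>"
  shows "f = g"
proof -
  have "mcoeff f \<nu> = mcoeff g \<nu>" for \<nu>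
    using assms mcoeff[of f] mcoeff[of g] by (cases "finite {j. \<nu> j \<noteq> 0}") auto
  thus ?thesis by (auto simp: mcoeff_inject[symmetric] fun_eq_iff)
qed

lemma mcoeff_infinite: "infinite {j. \<nu> j \<noteq> 0} \<Longrightarrow> mcoeff f \<nu> = 0"
  using mcoeff[of f] by simp

lemma mcoeff_Mps:
  "(\<And>\<nu>. infinite {j. \<nu> j \<noteq> 0} \<Longrightarrow> f \<nu> = 0) \<Longrightarrow> mcoeff (Mps f) = f"
  by (rule Mps_inverse) simp

instantiation mps :: (field) comm_ring_1
begin

definition zero_mps :: "'a mps" where "0 = Mps (\<lambda>_. 0)"
definition one_mps :: "'a mps" where "1 = Mps tone"
definition plus_mps :: "'a mps \<Rightarrow> 'a mps \<Rightarrow> 'a mps" where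
  "f + g = Mps (\<lambda>\<nu>. mcoeff f \<nu> + mcoeff g \<nu>)"
definition minus_mps :: "'a mps \<Rightarrow> 'a mps \<Rightarrow> 'a mps" where
  "f - g = Mps (\<lambda>\<nu>. mcoeff f \<nu> - mcoeff g \<nu>)"
definition uminus_mps :: "'a mps \<Rightarrow> 'a mps" where
  "- f = Mps (\<lambda>\<nu>. - mcoeff f \<nu>)"
definition times_mps :: "'a mps \<Rightarrow> 'a mps \<Rightarrow> 'a mps" where
  "f * g = Mps (tmul (mcoeff f) (mcoeff g))"

lemma tmul_infinite:
  "infinite {j. \<nu> j \<noteq> 0} \<Longrightarrow> tmul (mcoeff f) (mcoeff g) \<nu> = 0"
  unfolding tmul_splits
proof (rule sum.neutral, safe)
  fix a b assume "infinite {j. \<nu> j \<noteq> 0}" "(a, b) \<in> splits \<nu>"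
  hence "mcoeff f a = 0 \<or> mcoeff g b = 0"
    using splits_infinite_support mcoeff_infinite by blast
  thus "mcoeff f a * mcoeff g b = 0" by auto
qed

lemma mcoeff_simps [simp]:
  "mcoeff (0 :: 'a mps) \<nu> = 0"
  "mcoeff (f + g) \<nu> = mcoeff f \<nu> + mcoeff g \<nu>"
  "mcoeff (f - g) \<nu> = mcoeff f \<nu> - mcoeff g \<nu>"
  "mcoeff (- f) \<nu> = - mcoeff f \<nu>"
  unfolding zero_mps_def plus_mps_def minus_mps_def uminus_mps_def
  by (subst mcoeff_Mps; simp add: mcoeff_infinite)+

lemma mcoeff_one: "mcoeff (1 :: 'a mps) = tone"
  unfolding one_mps_def by (rule mcoeff_Mps) (auto simp: tone_def)

lemma mcoeff_times: "mcoeff (f * g) = tmul (mcoeff f) (mcoeff g)"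
  unfolding times_mps_def by (rule mcoeff_Mps) (rule tmul_infinite)

instance
proof
  fix a b c :: "'a mps"
  show "a * b * c = a * (b * c)"
  proof (rule mps_eqI)
    fix \<nu> :: "nat \<Rightarrow> nat" assume \<nu>: "finite {j. \<nu> j \<noteq> 0}"
    have fin: "\<forall>x\<in>splits \<nu>. finite (splits (fst x))" "\<forall>x\<in>splits \<nu>. finite (splits (snd x))"
      using splits_finite_support[OF _ \<nu>] by (auto intro!: finite_splits)
    have "mcoeff (a * b * c) \<nu> =
        (\<Sum>x\<in>splits \<nu>. \<Sum>y\<in>splits (fst x). mcoeff a (fst y) * mcoeff b (snd y) * mcoeff c (snd x))"
      by (simp add: mcoeff_times tmul_splits sum_distrib_right case_prod_unfold)
    also have "\<dots> = (\<Sum>(x, y)\<in>(SIGMA x:splits \<nu>. splits (fst x)).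
        mcoeff a (fst y) * mcoeff b (snd y) * mcoeff c (snd x))"
      by (rule sum.Sigma) (use \<nu> fin finite_splits in auto)
    also have "\<dots> = (\<Sum>(x, y)\<in>(SIGMA x:splits \<nu>. splits (snd x)).
        mcoeff a (fst x) * (mcoeff b (fst y) * mcoeff c (snd y)))"
      \<comment> \<open>Both sides run over decompositions of the exponent into three parts: ((a +
        b, c), (a, b)) corresponds to ((a, b + c), (b, c)).\<close>
      by (rule sum.reindex_bij_witness
          [of _ "\<lambda>(x, y). ((\<lambda>j. fst x j + fst y j, snd y), (fst x, fst y))"
                "\<lambda>(x, y). ((fst y, \<lambda>j. snd y j + snd x j), (snd y, snd x))"])
        (auto simp: splits_def fun_eq_iff mult.assoc, (metis add.assoc)+)
    also have "\<dots> =
        (\<Sum>x\<in>splits \<nu>. \<Sum>y\<in>splits (snd x). mcoeff a (fst x) * (mcoeff b (fst y) * mcoeff c (snd y)))"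
      by (rule sum.Sigma[symmetric]) (use \<nu> fin finite_splits in auto)
    also have "\<dots> = mcoeff (a * (b * c)) \<nu>"
      by (simp add: mcoeff_times tmul_splits sum_distrib_left case_prod_unfold)
    finally show "mcoeff (a * b * c) \<nu> = mcoeff (a * (b * c)) \<nu>" .
  qed
  show "a * b = b * a"
    by (rule mps_eqI, unfold mcoeff_times tmul_splits,
        rule sum.reindex_bij_witness[of _ prod.swap prod.swap])
      (auto simp: splits_def add.commute mult.commute)
  show "1 * a = a"
  proof (rule mps_eqI)
    fix \<nu> :: "nat \<Rightarrow> nat" assume \<nu>: "finite {j. \<nu> j \<noteq> 0}"
    have "mcoeff (1 * a) \<nu> = (\<Sum>(\<mu>, \<kappa>)\<in>{(\<lambda>_. 0, \<nu>)}. tone \<mu> * mcoeff a \<kappa>)"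
      unfolding mcoeff_times mcoeff_one tmul_splits
      by (rule sum.mono_neutral_right)
        (use finite_splits[OF \<nu>] in \<open>auto simp: splits_def tone_def fun_eq_iff split: if_splits\<close>)
    thus "mcoeff (1 * a) \<nu> = mcoeff a \<nu>" by (simp add: tone_def)
  qed
  show "(a + b) * c = a * c + b * c"
    by (rule mps_eqI) (simp add: mcoeff_times tmul_splits ring_distribs sum.distrib case_prod_unfold)
  have "mcoeff (0 :: 'a mps) (\<lambda>_. 0) \<noteq> mcoeff (1 :: 'a mps) (\<lambda>_. 0)"
    by (simp add: mcoeff_one tone_def)
  thus "(0 :: 'a mps) \<noteq> 1" by metis
qed (auto intro!: mps_eqI simp: algebra_simps)

end

lemma mcoeff_sum: "mcoeff (sum f S) \<nu> = (\<Sum>x\<in>S. mcoeff (f x) \<nu>)"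
  by (induction S rule: infinite_finite_induct) auto

definition mconst :: "'a::field \<Rightarrow> 'a mps" where "mconst c = Mps (tconst c)"

lemma mcoeff_mconst: "mcoeff (mconst c) = tconst c"
  unfolding mconst_def by (rule mcoeff_Mps) (auto simp: tconst_def)

lemma mcoeff_mconst_times: "mcoeff (mconst c * f) \<nu> = c * mcoeff f \<nu>"
proof (cases "finite {j. \<nu> j \<noteq> 0}")
  case True
  have "mcoeff (mconst c * f) \<nu> = (\<Sum>(\<mu>, \<kappa>)\<in>{(\<lambda>_. 0, \<nu>)}. tconst c \<mu> * mcoeff f \<kappa>)"
    unfolding mcoeff_times mcoeff_mconst tmul_splits
    by (rule sum.mono_neutral_right)
      (use finite_splits[OF True] in \<open>auto simp: splits_def tconst_def fun_eq_iff split: if_splits\<close>)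
  thus ?thesis by (simp add: tconst_def)
qed (simp add: mcoeff_infinite)

lemma mconst_mult: "mconst (a * b) = mconst a * mconst b"
  by (rule mps_eqI) (simp add: mcoeff_mconst_times mcoeff_mconst tconst_def)

lemma mconst_diff: "mconst (a - b) = mconst a - mconst b"
  by (rule mps_eqI) (simp add: mcoeff_mconst tconst_def)

lemma mconst_uminus: "mconst (- a) = - mconst a"
  by (rule mps_eqI) (simp add: mcoeff_mconst tconst_def)

lemma mconst_1: "mconst 1 = 1"
  by (rule mps_eqI) (simp add: mcoeff_mconst mcoeff_one tconst_def tone_def)

section \<open>Norm and Frobenius twists on the Tate algebra\<close>

definition mfrob :: "nat \<Rightarrow> int \<Rightarrow> 'a::field mps \<Rightarrow> 'a mps" where
  "mfrob q n f = Mps (tfrob q n (mcoeff f))"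

text \<open>A supremum such as \<open>gnorm\<close> is only usable together with a proof of
  boundedness. A common bound on the coefficients passes through sums, products and twists directly;
  \<open>gnorm\<close> reappears only where the given definitions speak of it.\<close>

definition norm_le :: "('a::field \<Rightarrow> real) \<Rightarrow> real \<Rightarrow> 'a mps \<Rightarrow> bool" where
  "norm_le av e f \<longleftrightarrow> (\<forall>\<nu>. av (mcoeff f \<nu>) \<le> e)"

lemma mcoeff_Mps_tate: "tate av s f \<Longrightarrow> mcoeff (Mps f) = f"
  by (rule mcoeff_Mps) (metis (mono_tags, lifting) tate_def finite_nat_set_iff_bounded mem_Collect_eq not_less)

locale C_infty =
  fixes av :: "'k::field \<Rightarrow> real" and p q s :: nat and th :: 'k
  assumes C_infty_field: "C_infty_field av p q th"
begin

section \<open>The ultrametric absolute value\<close>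

lemmas C_infty_field_conjs = C_infty_field[unfolded C_infty_field_def]

lemma prime_char: "prime CHAR('k)"
  using C_infty_field_conjs by (elim conjE) hypsubst

lemma q_eq: "\<exists>e>0. q = CHAR('k) ^ e"
  using C_infty_field_conjs by (elim conjE) hypsubst

lemma q_ge_2: "q \<ge> 2"
proof -
  from q_eq obtain e where e: "e > 0" "q = CHAR('k) ^ e" by (elim exE conjE)
  have "CHAR('k) ^ 1 \<le> CHAR('k) ^ e"
    using e(1) prime_gt_0_nat[OF prime_char] by (intro power_increasing) auto
  thus ?thesis using prime_ge_2_nat[OF prime_char] e(2) by simp
qed

lemma av_0 [simp]: "av 0 = 0"
  using C_infty_field_conjs by (elim conjE)

lemma av_pos: "x \<noteq> 0 \<Longrightarrow> av x > 0"
proof -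
  have "\<forall>x. x \<noteq> 0 \<longrightarrow> av x > 0" using C_infty_field_conjs by (elim conjE)
  thus "x \<noteq> 0 \<Longrightarrow> av x > 0" by blast
qed

lemma av_mult: "av (x * y) = av x * av y"
proof -
  have "\<forall>x y. av (x * y) = av x * av y" using C_infty_field_conjs by (elim conjE)
  thus ?thesis by blast
qed

lemma av_add: "av (x + y) \<le> max (av x) (av y)"
proof -
  have "\<forall>x y. av (x + y) \<le> max (av x) (av y)" using C_infty_field_conjs by (elim conjE)
  thus ?thesis by blast
qed

lemma av_th: "av th = real q"
  using C_infty_field_conjs by (elim conjE)

lemma complete:
  assumes "\<And>e. e > 0 \<Longrightarrow> \<exists>N. \<forall>m\<ge>N. \<forall>n\<ge>N. av (X m - X n) < e"
  shows "\<exists>L. (\<lambda>n. av (X n - L)) \<longlonglongrightarrow> 0"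
proof -
  have "\<forall>X::nat \<Rightarrow> 'k. (\<forall>e>0. \<exists>N. \<forall>m\<ge>N. \<forall>n\<ge>N. av (X m - X n) < e) \<longrightarrow>
         (\<exists>L. (\<lambda>n. av (X n - L)) \<longlonglongrightarrow> 0)"
    using C_infty_field_conjs by (elim conjE)
  thus ?thesis using assms by (elim allE[of _ X] impE) auto
qed

lemma alg_closed: "degree P > 0 \<Longrightarrow> \<exists>x. poly P x = (0::'k)"
proof -
  have "\<forall>P::'k poly. degree P > 0 \<longrightarrow> (\<exists>x. poly P x = 0)"
    using C_infty_field_conjs by (elim conjE)
  thus "degree P > 0 \<Longrightarrow> \<exists>x. poly P x = 0" by blast
qed

lemma av_nonneg [simp]: "av x \<ge> 0"
  using av_pos[of x] by (cases "x = 0") auto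

lemma av_1 [simp]: "av 1 = 1"
  using av_mult[of 1 1] av_pos[of 1] by simp

lemma av_uminus [simp]: "av (- x) = av x"
proof -
  have "av (-1) * av (-1) = 1" using av_mult[of "-1" "-1"] by simp
  hence "av (-1) = 1" using av_nonneg[of "-1"] by (simp add: power2_eq_1_iff flip: power2_eq_square)
  thus ?thesis using av_mult[of "-1" x] by simp
qed

lemma av_diff: "av (x - y) \<le> max (av x) (av y)"
  using av_add[of x "- y"] by simp

lemma av_power: "av (x ^ n) = av x ^ n"
  by (induction n) (auto simp: av_mult)

lemma av_eq_0_iff: "av x = 0 \<longleftrightarrow> x = 0"
  using av_pos[of x] by (cases "x = 0") auto

lemma av_add_le: "av x \<le> e \<Longrightarrow> av y \<le> e \<Longrightarrow> av (x + y) \<le> e"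
  using av_add[of x y] by linarith

lemma av_diff_le: "av x \<le> e \<Longrightarrow> av y \<le> e \<Longrightarrow> av (x - y) \<le> e"
  using av_diff[of x y] by linarith

lemma av_sum_le:
  assumes "\<And>x. x \<in> S \<Longrightarrow> av (f x) \<le> e" "e \<ge> 0"
  shows "av (sum f S) \<le> e"
  using assms by (induction S rule: infinite_finite_induct) (auto intro!: av_add_le)

section \<open>Powers of the Frobenius with integer exponents\<close>

lemma frob_add: "(x + y) ^ (q ^ n) = x ^ (q ^ n) + (y::'k) ^ (q ^ n)"
proof -
  obtain e where "q = CHAR('k) ^ e" using q_eq by blast
  thus ?thesis using freshmans_dream'[OF prime_char, of "q ^ n" "e * n"] by (simp add: power_mult)
qed

lemma frob_diff: "(x - y) ^ (q ^ n) = x ^ (q ^ n) - (y::'k) ^ (q ^ n)"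
  using frob_add[of "x - y" y n] by simp

lemma frob_inject: "x ^ (q ^ n) = (y::'k) ^ (q ^ n) \<longleftrightarrow> x = y"
  using frob_diff[of x y n] q_ge_2 by (metis eq_iff_diff_eq_0 power_eq_0_iff)

lemma frob_surj: "\<exists>y. y ^ (q ^ n) = (x::'k)"
proof -
  have n: "q ^ n > 0" using q_ge_2 by simp
  have "degree (monom 1 (q ^ n) + [:- x:]) = degree (monom 1 (q ^ n) :: 'k poly)"
    by (rule degree_add_eq_left) (use n in \<open>simp add: degree_monom_eq\<close>)
  hence "degree (monom 1 (q ^ n) + [:- x:]) > 0" using n by (simp add: degree_monom_eq)
  from alg_closed[OF this] show ?thesis by (auto simp: poly_monom)
qed

lemma frobk_nat [simp]: "frobk q (int n) x = x ^ (q ^ n)"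
  by (simp add: frobk_def)

text \<open>Writing the exponent as a difference a - b turns twists of either sign into one
  polynomial equation, so that additivity, multiplicativity and composition need no case distinction
  on the sign. For a < b the q^(b-a)-th root exists by algebraic closedness and is unique by
  injectivity of the Frobenius.\<close>

lemma frobk_iff: "frobk q (int a - int b) x = y \<longleftrightarrow> y ^ (q ^ b) = (x::'k) ^ (q ^ a)"
proof (cases "a \<ge> b")
  case True
  hence eq: "int a - int b = int (a - b)" "q ^ (a - b) * q ^ b = q ^ a"
    by (auto simp flip: power_add)
  have "frobk q (int a - int b) x = y \<longleftrightarrow> (x ^ (q ^ (a - b))) ^ (q ^ b) = y ^ (q ^ b)"
    unfolding eq(1) frobk_nat frob_inject ..
  also have "(x ^ (q ^ (a - b))) ^ (q ^ b) = x ^ (q ^ a)"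
    unfolding power_mult[symmetric] eq(2) ..
  finally show ?thesis by (simp only: eq_commute)
next
  case False
  hence eq: "nat (- (int a - int b)) = b - a" "\<not> int a - int b \<ge> 0" "q ^ (b - a) * q ^ a = q ^ b"
    by (auto simp flip: power_add)
  obtain z where z: "z ^ (q ^ (b - a)) = x" using frob_surj by blast
  have "frobk q (int a - int b) x = (THE y. y ^ (q ^ (b - a)) = x)"
    unfolding frobk_def eq(1) using eq(2) by simp
  also have "\<dots> = z"
    by (rule the_equality) (simp_all add: frob_inject z[symmetric])
  finally have "frobk q (int a - int b) x = y \<longleftrightarrow> y ^ (q ^ (b - a)) = z ^ (q ^ (b - a))"
    unfolding frob_inject by (simp only: eq_commute)
  also have "\<dots> \<longleftrightarrow> (y ^ (q ^ (b - a))) ^ (q ^ a) = x ^ (q ^ a)" unfolding z frob_inject ..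
  also have "(y ^ (q ^ (b - a))) ^ (q ^ a) = y ^ (q ^ b)"
    unfolding power_mult[symmetric] eq(3) ..
  finally show ?thesis .
qed

lemma frobk_power: "(frobk q (int a - int b) x) ^ (q ^ b) = (x::'k) ^ (q ^ a)"
  using frobk_iff by blast

lemma int_diff_nat_cases: obtains a b where "n = int a - int b"
  by (cases n rule: int_diff_cases) auto

lemma frobk_add: "frobk q n (x + y) = frobk q n x + frobk q n (y::'k)"
  by (cases n rule: int_diff_nat_cases) (simp add: frobk_iff frob_add frobk_power)

lemma frobk_mult: "frobk q n (x * y) = frobk q n x * frobk q n (y::'k)"
  by (cases n rule: int_diff_nat_cases) (simp add: frobk_iff power_mult_distrib frobk_power)

lemma frobk_0 [simp]: "frobk q n 0 = (0::'k)"
  by (cases n rule: int_diff_nat_cases) (use q_ge_2 in \<open>simp add: frobk_iff power_0_left\<close>)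

lemma frobk_1 [simp]: "frobk q n 1 = (1::'k)"
  by (cases n rule: int_diff_nat_cases) (simp add: frobk_iff)

lemma frobk_uminus: "frobk q n (- x) = - frobk q n (x::'k)"
  using frobk_add[of n x "- x"] frobk_0 by (metis add.commute add.right_inverse eq_neg_iff_add_eq_0)

lemma frobk_diff: "frobk q n (x - y) = frobk q n x - frobk q n (y::'k)"
  using frobk_add[of n x "- y"] by (simp add: frobk_uminus)

lemma frobk_sum: "frobk q n (sum f S) = (\<Sum>x\<in>S. frobk q n (f x :: 'k))"
  by (induction S rule: infinite_finite_induct) (auto simp: frobk_add)

lemma frobk_frobk: "frobk q m (frobk q n x) = frobk q (m + n) (x::'k)"
proof -
  obtain a b where m: "m = int a - int b" by (rule int_diff_nat_cases)
  obtain c d where n: "n = int c - int d" by (rule int_diff_nat_cases)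
  have "(frobk q m (frobk q n x)) ^ (q ^ (b + d)) = ((frobk q m (frobk q n x)) ^ (q ^ b)) ^ (q ^ d)"
    by (simp only: power_add power_mult)
  also have "\<dots> = ((frobk q n x) ^ (q ^ d)) ^ (q ^ a)"
    unfolding m frobk_power by (simp only: power_mult[symmetric] mult.commute)
  also have "\<dots> = x ^ (q ^ (a + c))"
    unfolding n frobk_power by (simp only: power_mult[symmetric] power_add mult.commute)
  finally have "frobk q (int (a + c) - int (b + d)) x = frobk q m (frobk q n x)"
    unfolding frobk_iff .
  moreover have "m + n = int (a + c) - int (b + d)" by (simp add: m n)
  ultimately show ?thesis by simp
qed

text \<open>A twist by n raises absolute values to the power q^n, which is continuous at 0 also for
  negative n. A negative twist enlarges small values, so an epsilon-delta statement replaces a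
  linear bound.\<close>

lemma frobk_small:
  assumes "e > 0"
  shows "\<exists>d>0. \<forall>x. av x < d \<longrightarrow> av (frobk q n x) < e"
proof -
  obtain a b where n: "n = int a - int b" by (rule int_diff_nat_cases)
  \<comment> \<open>Chosen so that d^(q^a) = e^(q^b), matching the relation |y|^(q^b) = |x|^(q^a)
    between x and its twist y.\<close>
  define d where "d = root (q ^ a) (e ^ (q ^ b))"
  have pos: "q ^ a > 0" "q ^ b > 0" using q_ge_2 by auto
  have d: "d > 0" "d ^ (q ^ a) = e ^ (q ^ b)"
    unfolding d_def using assms pos by (auto simp: real_root_gt_zero)
  have "av (frobk q n x) < e" if "av x < d" for x
  proof -
    have "av (frobk q n x) ^ (q ^ b) = av x ^ (q ^ a)"
      using frobk_power[of a b x] by (simp add: n flip: av_power)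
    also have "\<dots> < d ^ (q ^ a)" using that pos by (intro power_strict_mono) auto
    finally have "av (frobk q n x) ^ (q ^ b) < e ^ (q ^ b)" unfolding d(2) .
    thus ?thesis by (rule power_less_imp_less_base) (use assms in simp)
  qed
  thus ?thesis using d(1) by blast
qed

section \<open>Twists and norm bounds on power series\<close>

lemma mcoeff_mfrob [simp]: "mcoeff (mfrob q n f) \<nu> = frobk q n (mcoeff f \<nu> :: 'k)"
proof -
  have "mcoeff (mfrob q n f) = tfrob q n (mcoeff f)" unfolding mfrob_def
    by (rule mcoeff_Mps) (simp add: tfrob_def mcoeff_infinite)
  thus ?thesis by (simp add: tfrob_def)
qed

lemma mcoeff_mfrob_raw: "mcoeff (mfrob q n f) = tfrob q n (mcoeff f :: 'k tate)"
  by (simp add: tfrob_def fun_eq_iff)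

lemma mfrob_add: "mfrob q n (f + g) = mfrob q n f + mfrob q n (g :: 'k mps)"
  by (rule mps_eqI) (simp add: frobk_add)

lemma mfrob_mult: "mfrob q n (f * g) = mfrob q n f * mfrob q n (g :: 'k mps)"
  by (rule mps_eqI) (simp add: mcoeff_times tmul_splits frobk_sum frobk_mult case_prod_unfold)

lemma mfrob_0 [simp]: "mfrob q n 0 = (0 :: 'k mps)"
  by (rule mps_eqI) simp

lemma mfrob_1 [simp]: "mfrob q n 1 = (1 :: 'k mps)"
  by (rule mps_eqI) (simp add: mcoeff_one tone_def)

lemma mfrob_diff: "mfrob q n (f - g) = mfrob q n f - mfrob q n (g :: 'k mps)"
  by (rule mps_eqI) (simp add: frobk_diff)

lemma mfrob_sum: "mfrob q n (sum f S) = (\<Sum>x\<in>S. mfrob q n (f x :: 'k mps))"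
  by (induction S rule: infinite_finite_induct) (auto simp: mfrob_add)

lemma mfrob_mfrob: "mfrob q m (mfrob q n f) = mfrob q (m + n) (f :: 'k mps)"
  by (rule mps_eqI) (simp add: frobk_frobk)

lemma mfrob_zero [simp]: "mfrob q 0 f = (f :: 'k mps)"
  by (rule mps_eqI) (simp add: frobk_def)

lemma mfrob_mconst: "mfrob q (int n) (mconst c) = mconst (c ^ (q ^ n) :: 'k)"
  by (rule mps_eqI) (use q_ge_2 in \<open>simp add: mcoeff_mconst tconst_def\<close>)

lemma norm_le_nonneg: "norm_le av e f \<Longrightarrow> e \<ge> 0"
  using av_nonneg order_trans unfolding norm_le_def by blast

lemma norm_le_mono: "norm_le av e f \<Longrightarrow> e \<le> e' \<Longrightarrow> norm_le av e' f"
  unfolding norm_le_def using order_trans by blast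

lemma norm_le_0 [simp]: "norm_le av e 0 \<longleftrightarrow> e \<ge> 0"
  by (simp add: norm_le_def)

lemma norm_le_add: "norm_le av e f \<Longrightarrow> norm_le av e g \<Longrightarrow> norm_le av e (f + g)"
  unfolding norm_le_def by (auto intro!: av_add_le)

lemma norm_le_diff: "norm_le av e f \<Longrightarrow> norm_le av e g \<Longrightarrow> norm_le av e (f - g)"
  unfolding norm_le_def by (auto intro!: av_diff_le)

lemma norm_le_sum:
  "(\<And>x. x \<in> S \<Longrightarrow> norm_le av e (f x)) \<Longrightarrow> e \<ge> 0 \<Longrightarrow> norm_le av e (sum f S)"
  unfolding norm_le_def mcoeff_sum by (auto intro: av_sum_le)

lemma norm_le_mult: "norm_le av a f \<Longrightarrow> norm_le av b g \<Longrightarrow> norm_le av (a * b) (f * g)"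
  using norm_le_nonneg[of a f] norm_le_nonneg[of b g]
  unfolding norm_le_def mcoeff_times tmul_splits
  by (intro allI av_sum_le) (auto simp: av_mult intro!: mult_mono)

lemma norm_le_mfrob: "norm_le av e f \<Longrightarrow> norm_le av (e ^ (q ^ n)) (mfrob q (int n) f)"
  unfolding norm_le_def by (auto simp: av_power intro!: power_mono)

section \<open>Closure properties and completeness of the Tate algebra\<close>

lemma tate_finite: "tate av s f \<Longrightarrow> e > 0 \<Longrightarrow> finite {\<nu>. av (f \<nu>) \<ge> e}"
  by (simp add: tate_def)

lemma tate_bounded:
  assumes "tate av s (mcoeff f)"
  shows "\<exists>C. norm_le av C f"
proof -
  let ?S = "{\<nu>. av (mcoeff f \<nu>) \<ge> 1}"
  have fin: "finite ?S" by (rule tate_finite[OF assms]) simp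
  have "av (mcoeff f \<nu>) \<le> max 1 (Max ((\<lambda>\<nu>. av (mcoeff f \<nu>)) ` ?S))" for \<nu>
    using fin by (cases "\<nu> \<in> ?S") (auto intro: max.coboundedI2)
  thus ?thesis unfolding norm_le_def by blast
qed

text \<open>If both factors are bounded by B and a coefficient of the product is at least e, then
  the ultrametric inequality yields a summand above e/2, so both of its factors are at least e/(2B).
  The exponent is therefore a sum of members of two finite sets.\<close>

lemma tate_mult:
  assumes f: "tate av s (mcoeff f)" and g: "tate av s (mcoeff g)"
  shows "tate av s (mcoeff (f * g))"
proof -
  have "mcoeff (f * g) \<nu> = 0" if "j \<ge> s" "\<nu> j \<noteq> 0" for \<nu> j
    unfolding mcoeff_times tmul_splits
  proof (rule sum.neutral, safe)
    fix a b assume "(a, b) \<in> splits \<nu>"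
    hence "a j \<noteq> 0 \<or> b j \<noteq> 0" using that(2) by (auto simp: splits_def dest!: spec[of _ j])
    hence "mcoeff f a = 0 \<or> mcoeff g b = 0" using f g that(1) unfolding tate_def by blast
    thus "mcoeff f a * mcoeff g b = 0" by auto
  qed
  moreover have "finite {\<nu>. av (mcoeff (f * g) \<nu>) \<ge> e}" if e: "e > 0" for e
  proof -
    obtain C D where C: "norm_le av C f" and D: "norm_le av D g"
      using tate_bounded f g by blast
    define B where "B = max 1 (max C D)"
    have B: "av (mcoeff f \<nu>) \<le> B" "av (mcoeff g \<nu>) \<le> B" "B > 0" for \<nu>
      using C D unfolding norm_le_def B_def by (simp_all add: le_max_iff_disj)
    define F where "F = {\<nu>. av (mcoeff f \<nu>) \<ge> e / (2 * B)} \<times> {\<nu>. av (mcoeff g \<nu>) \<ge> e / (2 * B)}"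
    have "finite F" unfolding F_def using tate_finite[OF f] tate_finite[OF g] e B(3) by auto
    moreover have "{\<nu>. av (mcoeff (f * g) \<nu>) \<ge> e} \<subseteq> (\<lambda>(a, b) j. a j + b j) ` F"
    proof
      fix \<nu> assume "\<nu> \<in> {\<nu>. av (mcoeff (f * g) \<nu>) \<ge> e}"
      hence "\<not> av (mcoeff (f * g) \<nu>) \<le> e / 2" using e by auto
      then obtain a b where ab: "(a, b) \<in> splits \<nu>" "av (mcoeff f a) * av (mcoeff g b) > e / 2"
        unfolding mcoeff_times tmul_splits
        using av_sum_le[of "splits \<nu>" "\<lambda>(\<mu>, \<kappa>). mcoeff f \<mu> * mcoeff g \<kappa>" "e / 2"] e
        by (force simp: av_mult)
      have "e / 2 < av (mcoeff f a) * B" "e / 2 < B * av (mcoeff g b)"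
        using ab(2) B mult_left_mono[OF B(2)[of b] av_nonneg[of "mcoeff f a"]]
          mult_right_mono[OF B(1)[of a] av_nonneg[of "mcoeff g b"]] by linarith+
      hence "(a, b) \<in> F" using B(3) by (auto simp: F_def field_simps)
      moreover have "\<nu> = (\<lambda>j. a j + b j)" using ab(1) by (auto simp: splits_def)
      ultimately show "\<nu> \<in> (\<lambda>(a, b) j. a j + b j) ` F" by force
    qed
    ultimately show ?thesis using finite_surj by blast
  qed
  ultimately show ?thesis unfolding tate_def by blast
qed

lemma tate_0 [simp]: "tate av s (mcoeff 0)"
proof -
  have "mcoeff 0 = (\<lambda>_. 0 :: 'k)" by (simp add: fun_eq_iff)
  thus ?thesis by (simp add: tate_def)
qed

lemma tate_add:
  assumes "tate av s (mcoeff f)" "tate av s (mcoeff g)"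
  shows "tate av s (mcoeff (f + g))"
proof -
  have "{\<nu>. av (mcoeff (f + g) \<nu>) \<ge> e} \<subseteq> {\<nu>. av (mcoeff f \<nu>) \<ge> e} \<union> {\<nu>. av (mcoeff g \<nu>) \<ge> e}" for e
    using av_add[of "mcoeff f _" "mcoeff g _"] by (fastforce simp: le_max_iff_disj dest: order_trans)
  thus ?thesis using assms unfolding tate_def mcoeff_simps
    by (metis (no_types, lifting) add_0 finite_Un finite_subset)
qed

lemma tate_uminus: "tate av s (mcoeff f) \<Longrightarrow> tate av s (mcoeff (- f))"
  by (simp add: tate_def)

lemma tate_diff: "tate av s (mcoeff f) \<Longrightarrow> tate av s (mcoeff g) \<Longrightarrow> tate av s (mcoeff (f - g))"
  using tate_add[OF _ tate_uminus] by (metis diff_conv_add_uminus)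

lemma tate_sum: "(\<And>x. x \<in> S \<Longrightarrow> tate av s (mcoeff (f x))) \<Longrightarrow> tate av s (mcoeff (sum f S))"
  by (induction S rule: infinite_finite_induct) (auto intro: tate_add)

lemma tate_tconst: "tate av s (tconst c)"
proof -
  have "{\<nu>. av (tconst c \<nu>) \<ge> e} \<subseteq> {\<lambda>_. 0}" if "e > 0" for e
    using that by (auto simp: tconst_def split: if_splits)
  thus ?thesis unfolding tate_def using finite_subset by (auto simp: tconst_def)
qed

lemma tate_mconst: "tate av s (mcoeff (mconst c))"
  unfolding mcoeff_mconst by (rule tate_tconst)

lemma tate_1: "tate av s (mcoeff 1)"
  using tate_mconst[of 1] by (simp add: mconst_1)

lemma tate_mfrob:
  assumes "tate av s (mcoeff f)"
  shows "tate av s (mcoeff (mfrob q n f))"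
proof -
  have "finite {\<nu>. av (mcoeff (mfrob q n f) \<nu>) \<ge> e}" if "e > 0" for e
  proof -
    obtain d where d: "d > 0" "\<And>x. av x < d \<Longrightarrow> av (frobk q n x) < e"
      using frobk_small[OF \<open>e > 0\<close>] by blast
    have "{\<nu>. av (mcoeff (mfrob q n f) \<nu>) \<ge> e} \<subseteq> {\<nu>. av (mcoeff f \<nu>) \<ge> d}"
      using d(2) by (force simp: not_le[symmetric])
    thus ?thesis using tate_finite[OF assms d(1)] finite_subset by blast
  qed
  thus ?thesis using assms by (auto simp: tate_def)
qed

lemma norm_le_gnorm:
  assumes "tate av s f"
  shows "norm_le av (gnorm av f) (Mps f)"
proof -
  obtain C where "norm_le av C (Mps f)"
    using tate_bounded[of "Mps f"] assms mcoeff_Mps_tate[OF assms] by auto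
  hence "bdd_above (range (\<lambda>\<nu>. av (f \<nu>)))"
    by (auto simp: norm_le_def mcoeff_Mps_tate[OF assms] intro!: bdd_aboveI)
  thus ?thesis unfolding norm_le_def gnorm_def mcoeff_Mps_tate[OF assms]
    by (auto intro: cSUP_upper)
qed

lemma gnorm_le: "norm_le av e f \<Longrightarrow> gnorm av (mcoeff f) \<le> e"
  unfolding norm_le_def gnorm_def by (auto intro: cSUP_least)

lemma gnorm_nonneg: "norm_le av e f \<Longrightarrow> gnorm av (mcoeff f) \<ge> 0"
proof -
  assume "norm_le av e f"
  hence "bdd_above (range (\<lambda>\<nu>. av (mcoeff f \<nu>)))"
    by (auto simp: norm_le_def intro!: bdd_aboveI)
  hence "av (mcoeff f \<nu>) \<le> gnorm av (mcoeff f)" for \<nu>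
    unfolding gnorm_def by (intro cSUP_upper) auto
  thus ?thesis by (rule order_trans[OF av_nonneg])
qed

text \<open>Because \<open>c\<close> decreases, the ultrametric inequality bounds every later
  difference F (n + k) - F n by c n. Limits exist coefficient by coefficient, and the bound survives
  the passage to the limit uniformly in the exponent. This uniformity puts the limit into the Tate
  algebra: its coefficients of size at least e > c N occur only where those of F N are that
  large.\<close>

lemma norm_le_complete:
  assumes T: "\<And>n. tate av s (mcoeff (F n))"
    and step: "\<And>n. norm_le av (c n) (F (Suc n) - F n)"
    and c: "decseq c" "c \<longlonglongrightarrow> 0"
  shows "\<exists>y. tate av s (mcoeff y) \<and> (\<forall>n. norm_le av (c n) (F n - y))"
proof -
  have cau: "norm_le av (c n) (F (n + k) - F n)" for n k
  proof (induction k)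
    case (Suc k)
    have "norm_le av (c n) (F (Suc (n + k)) - F (n + k))"
      using step[of "n + k"] by (rule norm_le_mono) (use c(1) in \<open>auto simp: decseq_def\<close>)
    from norm_le_add[OF this Suc] show ?case by simp
  qed (use norm_le_nonneg[OF step] in auto)
  have c0: "c n \<ge> 0" for n using norm_le_nonneg[OF step] .
  have "\<exists>L. (\<lambda>n. av (mcoeff (F n) \<nu> - L)) \<longlonglongrightarrow> 0" for \<nu>
  proof (rule complete)
    fix e :: real assume "e > 0"
    then obtain N where N: "c N < e"
      using order_tendstoD(2)[OF c(2)] by (metis eventually_sequentially order_refl)
    have *: "av (mcoeff (F n) \<nu> - mcoeff (F N) \<nu>) \<le> c N" if "n \<ge> N" for n
      using cau[of N "n - N"] that by (simp add: norm_le_def)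
    have "av (mcoeff (F m) \<nu> - mcoeff (F n) \<nu>) < e" if "m \<ge> N" "n \<ge> N" for m n
      using av_diff[of "mcoeff (F m) \<nu> - mcoeff (F N) \<nu>" "mcoeff (F n) \<nu> - mcoeff (F N) \<nu>"]
        *[OF that(1)] *[OF that(2)] N by (auto simp: max_def split: if_splits)
    thus "\<exists>N. \<forall>m\<ge>N. \<forall>n\<ge>N. av (mcoeff (F m) \<nu> - mcoeff (F n) \<nu>) < e" by blast
  qed
  then obtain L where L: "\<And>\<nu>. (\<lambda>n. av (mcoeff (F n) \<nu> - L \<nu>)) \<longlonglongrightarrow> 0" by metis
  have Lle: "av (mcoeff (F n) \<nu> - L \<nu>) \<le> c n" for n \<nu>
  proof -
    have "av (mcoeff (F n) \<nu> - L \<nu>) \<le> max (c n) (av (mcoeff (F (m + n)) \<nu> - L \<nu>))" for m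
      using av_diff[of "mcoeff (F (m + n)) \<nu> - L \<nu>" "mcoeff (F (m + n)) \<nu> - mcoeff (F n) \<nu>"]
        cau[of n m] by (auto simp: norm_le_def add.commute max_def split: if_splits intro: order_trans)
    moreover have "(\<lambda>m. max (c n) (av (mcoeff (F (m + n)) \<nu> - L \<nu>))) \<longlonglongrightarrow> max (c n) 0"
      by (intro tendsto_max tendsto_const LIMSEQ_ignore_initial_segment L)
    ultimately have "av (mcoeff (F n) \<nu> - L \<nu>) \<le> max (c n) 0"
      by (intro LIMSEQ_le_const) auto
    thus ?thesis using c0[of n] by simp
  qed
  have "L \<nu> = 0" if "j \<ge> s" "\<nu> j \<noteq> 0" for \<nu> j
  proof -
    have "mcoeff (F n) \<nu> = 0" for n using T[of n] that unfolding tate_def by blast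
    hence "(\<lambda>n. av (L \<nu>)) \<longlonglongrightarrow> 0" using L[of \<nu>] by simp
    thus ?thesis by (simp add: LIMSEQ_const_iff av_eq_0_iff)
  qed
  moreover have "finite {\<nu>. av (L \<nu>) \<ge> e}" if "e > 0" for e
  proof -
    obtain N where N: "c N < e"
      using order_tendstoD(2)[OF c(2) \<open>e > 0\<close>] by (metis eventually_sequentially order_refl)
    have "av (L \<nu>) \<le> max (av (mcoeff (F N) \<nu>)) (c N)" for \<nu>
      using av_diff[of "mcoeff (F N) \<nu>" "mcoeff (F N) \<nu> - L \<nu>"] Lle[of N \<nu>]
      by (auto simp: max_def split: if_splits intro: order_trans)
    hence "{\<nu>. av (L \<nu>) \<ge> e} \<subseteq> {\<nu>. av (mcoeff (F N) \<nu>) \<ge> e}"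
      using N by (smt (verit) Collect_mono max_def)
    thus ?thesis using tate_finite[OF T \<open>e > 0\<close>] finite_subset by blast
  qed
  ultimately have TL: "tate av s L" by (auto simp: tate_def)
  show ?thesis
    by (rule exI[of _ "Mps L"]) (use TL Lle in \<open>simp add: mcoeff_Mps_tate[OF TL] norm_le_def\<close>)
qed

end

section \<open>The exponential of a Drinfeld module\<close>

locale drinfeld = C_infty av p q s th
  for av :: "'k::field \<Rightarrow> real" and p q s :: nat and th :: 'k +
  fixes r :: nat and A :: "nat \<Rightarrow> 'k tate"
  assumes tate_A: "i \<in> {1..r} \<Longrightarrow> tate av s (A i)"
begin

section \<open>The operator phi_theta and the coefficients of its exponential\<close>

definition coef :: "nat \<Rightarrow> 'k mps" where
  "coef j = Mps (phi_coeff th A j)"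

definition phi :: "'k mps \<Rightarrow> 'k mps" where
  "phi x = (\<Sum>j\<le>r. coef j * mfrob q (int j) x)"

lemma tate_phi_coeff: "j \<le> r \<Longrightarrow> tate av s (phi_coeff th A j)"
  using tate_A[of j] by (auto simp: phi_coeff_def tate_tconst)

lemma mcoeff_coef: "j \<le> r \<Longrightarrow> mcoeff (coef j) = phi_coeff th A j"
  unfolding coef_def by (rule mcoeff_Mps_tate[OF tate_phi_coeff])

lemma tate_coef: "j \<le> r \<Longrightarrow> tate av s (mcoeff (coef j))"
  by (simp add: mcoeff_coef tate_phi_coeff)

lemma coef_0: "coef 0 = mconst th"
  by (simp add: coef_def phi_coeff_def mconst_def)

text \<open>Since |theta| = q > 1, the power theta^(q^n) dominates theta. The consequence used later
  is that dividing by this difference does not increase norms.\<close>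

lemma av_th_power_diff: "n > 0 \<Longrightarrow> av (th ^ (q ^ n) - th) \<ge> 1"
proof -
  assume "n > 0"
  have q: "real q \<ge> 2" using q_ge_2 by simp
  have "q ^ n \<ge> q ^ 1" using q_ge_2 \<open>n > 0\<close> by (intro power_increasing) auto
  hence n: "q ^ n \<ge> 2" using q_ge_2 by simp
  have "real q < real q ^ 2" using q by (simp add: power2_eq_square)
  also have "\<dots> \<le> real q ^ (q ^ n)" using q n by (intro power_increasing) auto
  also have "\<dots> = av (th ^ (q ^ n))" by (simp add: av_power av_th)
  finally have less: "real q < av (th ^ (q ^ n))" .
  have "av (th ^ (q ^ n)) \<le> max (av (th ^ (q ^ n) - th)) (real q)"
    using av_add[of "th ^ (q ^ n) - th" th] by (simp add: av_th)
  thus ?thesis using less q by linarith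
qed

lemma th_power_diff_nz: "n > 0 \<Longrightarrow> th ^ (q ^ n) - th \<noteq> 0"
  using av_th_power_diff[of n] by auto

text \<open>The coefficient of tau^n in exp theta = phi_theta exp, solved for alpha_n: the terms
  alpha_n theta^(q^n) and theta alpha_n combine to the denominator.\<close>

fun alpha :: "nat \<Rightarrow> 'k mps" where
  "alpha n = (if n = 0 then 1 else mconst (inverse (th ^ (q ^ n) - th)) *
     (\<Sum>j\<in>{1..min n r}. coef j * mfrob q (int j) (alpha (n - j))))"

declare alpha.simps [simp del]

lemma alpha_0: "alpha 0 = 1"
  by (simp add: alpha.simps)

text \<open>Stated for an arbitrary sequence \<open>x\<close>, so that one equivalence serves both
  existence and uniqueness of the exponential. The summand j = 0 is theta x_n; moving it to the left
  leaves the invertible factor theta^(q^n) - theta.\<close>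

lemma exp_rec_iff:
  assumes "n > 0"
  shows "x n * mconst (th ^ (q ^ n)) = (\<Sum>j\<in>{0..min n r}. coef j * mfrob q (int j) (x (n - j))) \<longleftrightarrow>
    x n = mconst (inverse (th ^ (q ^ n) - th)) *
      (\<Sum>j\<in>{1..min n r}. coef j * mfrob q (int j) (x (n - j)))" (is "?L \<longleftrightarrow> x n = ?c * ?S")
proof -
  let ?d = "mconst (th ^ (q ^ n) - th)"
  have inv: "?c * ?d = 1"
    using th_power_diff_nz[OF assms] by (simp flip: mconst_mult mconst_1)
  have "(\<Sum>j\<in>{0..min n r}. coef j * mfrob q (int j) (x (n - j))) = mconst th * x n + ?S"
    by (subst sum.atLeast_Suc_atMost) (auto simp: coef_0)
  hence "?L \<longleftrightarrow> x n * ?d = ?S"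
    by (simp add: mconst_diff algebra_simps)
  also have "\<dots> \<longleftrightarrow> x n = ?c * ?S"
  proof
    assume "x n * ?d = ?S"
    hence "?c * ?S = ?c * (x n * ?d)" by (rule arg_cong[OF sym])
    also have "\<dots> = (?c * ?d) * x n" by (simp only: mult_ac)
    finally show "x n = ?c * ?S" unfolding inv by simp
  next
    assume "x n = ?c * ?S"
    hence "x n * ?d = (?c * ?S) * ?d" by (rule arg_cong)
    also have "\<dots> = (?c * ?d) * ?S" by (simp only: mult_ac)
    finally show "x n * ?d = ?S" unfolding inv by simp
  qed
  finally show ?thesis .
qed

lemma alpha_rec:
  "alpha n * mconst (th ^ (q ^ n)) = (\<Sum>j\<in>{0..min n r}. coef j * mfrob q (int j) (alpha (n - j)))"
proof (cases "n = 0")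
  case False
  thus ?thesis by (subst exp_rec_iff) (simp_all add: alpha.simps[of n])
qed (simp add: coef_0 mult.commute)

lemma tate_alpha: "tate av s (mcoeff (alpha n))"
proof (induction n rule: less_induct)
  case (less n)
  show ?case
    by (subst alpha.simps)
      (auto simp: tate_1 intro!: tate_mult tate_mconst tate_sum tate_coef tate_mfrob less)
qed

lemma is_exp_coeffs_alpha: "is_exp_coeffs av q s th r A (\<lambda>n. mcoeff (alpha n))"
  unfolding is_exp_coeffs_def
proof (intro conjI allI)
  show "tate av s (mcoeff (alpha i))" for i by (rule tate_alpha)
  show "mcoeff (alpha 0) = tone" by (simp add: alpha_0 mcoeff_one)
  show "tmul (mcoeff (alpha n)) (tconst (th ^ q ^ n)) =
    (\<lambda>\<nu>. \<Sum>j\<in>{0..min n r}. tmul (phi_coeff th A j) (tfrob q (int j) (mcoeff (alpha (n - j)))) \<nu>)" for n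
    using arg_cong[OF alpha_rec[of n], of mcoeff]
    by (simp add: mcoeff_times mcoeff_mconst fun_eq_iff mcoeff_sum mcoeff_coef flip: mcoeff_mfrob_raw)
qed

text \<open>Needed because \<open>exp_coeffs\<close> is a definite description. The Tate condition
  on \<beta> is what allows the raw functions to be read as elements of \<open>mps\<close>, where
  the recursion determines them.\<close>

lemma is_exp_coeffs_unique:
  assumes "is_exp_coeffs av q s th r A \<beta>"
  shows "\<beta> = (\<lambda>n. mcoeff (alpha n))"
proof
  fix n
  define b where "b = (\<lambda>n. Mps (\<beta> n))"
  have \<beta>: "\<beta> n = mcoeff (b n)" for n
    using assms mcoeff_Mps_tate unfolding is_exp_coeffs_def b_def by metis
  have rec: "b n * mconst (th ^ (q ^ n)) = (\<Sum>j\<in>{0..min n r}. coef j * mfrob q (int j) (b (n - j)))" for n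
  proof (rule mps_eqI)
    fix \<nu>
    have "tmul (\<beta> n) (tconst (th ^ q ^ n)) =
       (\<lambda>\<nu>. \<Sum>j\<in>{0..min n r}. tmul (phi_coeff th A j) (tfrob q (int j) (\<beta> (n - j))) \<nu>)"
      using assms unfolding is_exp_coeffs_def by blast
    thus "mcoeff (b n * mconst (th ^ (q ^ n))) \<nu> =
        mcoeff (\<Sum>j\<in>{0..min n r}. coef j * mfrob q (int j) (b (n - j))) \<nu>"
      by (simp add: \<beta> mcoeff_times mcoeff_mconst fun_eq_iff mcoeff_sum mcoeff_coef flip: mcoeff_mfrob_raw)
  qed
  have b0: "b 0 = 1"
    using assms by (simp add: is_exp_coeffs_def b_def one_mps_def)
  have "b n = alpha n"
  proof (induction n rule: less_induct)
    case (less n)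
    show ?case
    proof (cases "n = 0")
      case False
      have "b n = mconst (inverse (th ^ (q ^ n) - th)) *
          (\<Sum>j\<in>{1..min n r}. coef j * mfrob q (int j) (b (n - j)))"
        using rec[of n] exp_rec_iff[of n b] False by simp
      also have "\<dots> = alpha n"
        using False by (subst alpha.simps) (auto intro!: arg_cong2[of _ _ _ _ times] sum.cong simp: less)
      finally show ?thesis .
    qed (simp add: b0 alpha_0)
  qed
  thus "\<beta> n = mcoeff (alpha n)" by (simp add: \<beta>)
qed

lemma exp_coeffs_eq: "exp_coeffs av q s th r A = (\<lambda>n. mcoeff (alpha n))"
  unfolding exp_coeffs_def
  by (rule the_equality) (rule is_exp_coeffs_alpha, rule is_exp_coeffs_unique)

section \<open>Convergence of the exponential series\<close>

definition exp_sum :: "nat \<Rightarrow> 'k mps \<Rightarrow> 'k mps" where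
  "exp_sum n y = (\<Sum>i<n. alpha i * mfrob q (int i) y)"

definition exp_tends :: "'k mps \<Rightarrow> 'k mps \<Rightarrow> bool" where
  "exp_tends y g \<longleftrightarrow> (\<forall>e>0. \<exists>N. \<forall>n\<ge>N. norm_le av e (exp_sum n y - g))"

lemma exp_tends_converges:
  assumes "exp_tends y g"
  shows "exp_converges_to av q (exp_coeffs av q s th r A) (mcoeff y) (mcoeff g)"
proof -
  have eq: "(\<lambda>\<nu>. (\<Sum>i<n. tmul (exp_coeffs av q s th r A i) (tfrob q (int i) (mcoeff y)) \<nu>) - mcoeff g \<nu>)
      = mcoeff (exp_sum n y - g)" for n
    by (simp add: fun_eq_iff exp_coeffs_eq exp_sum_def mcoeff_sum mcoeff_times flip: mcoeff_mfrob_raw)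
  show ?thesis unfolding exp_converges_to_def eq
  proof (rule LIMSEQ_I)
    fix e :: real assume "e > 0"
    \<comment> \<open>\<open>norm_le\<close> gives a non-strict bound, while the limit asks for a
      strict one; hence e/2.\<close>
    then obtain N where N: "\<And>n. n \<ge> N \<Longrightarrow> norm_le av (e / 2) (exp_sum n y - g)"
      using assms unfolding exp_tends_def by (metis half_gt_zero)
    have "norm (gnorm av (mcoeff (exp_sum n y - g)) - 0) < e" if "n \<ge> N" for n
      using gnorm_nonneg[OF N[OF that]] gnorm_le[OF N[OF that]] \<open>e > 0\<close> by simp
    thus "\<exists>N. \<forall>n\<ge>N. norm (gnorm av (mcoeff (exp_sum n y - g)) - 0) < e" by blast
  qed
qed

lemma coef_bound: "\<exists>M\<ge>1. \<forall>j\<le>r. norm_le av M (coef j)"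
proof -
  have "\<exists>C. norm_le av C (coef j)" if "j \<le> r" for j
    using tate_bounded tate_coef that by blast
  then obtain C where C: "\<And>j. j \<le> r \<Longrightarrow> norm_le av (C j) (coef j)" by metis
  have "norm_le av (1 + (\<Sum>j\<le>r. \<bar>C j\<bar>)) (coef j)" if "j \<le> r" for j
  proof (rule norm_le_mono[OF C[OF that]])
    have "\<bar>C j\<bar> \<le> (\<Sum>j\<le>r. \<bar>C j\<bar>)" using that by (intro member_le_sum) auto
    thus "C j \<le> 1 + (\<Sum>j\<le>r. \<bar>C j\<bar>)" by linarith
  qed
  moreover have "1 + (\<Sum>j\<le>r. \<bar>C j\<bar>) \<ge> 1" by (simp add: sum_nonneg)
  ultimately show ?thesis by blast
qed

lemma norm_le_mconst_mult: "av c \<le> 1 \<Longrightarrow> norm_le av e f \<Longrightarrow> norm_le av e (mconst c * f)"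
proof -
  assume "av c \<le> 1" "norm_le av e f"
  hence "av c * av (mcoeff f \<nu>) \<le> 1 * e" for \<nu>
    by (intro mult_mono) (auto simp: norm_le_def)
  thus ?thesis by (simp add: norm_le_def mcoeff_mconst_times av_mult)
qed

text \<open>A summand of the recursion is bounded by M to the power 1 + (q^(n-j) - 1) q^j = q^n -
  (q^j - 1). This is at most q^n - 1 because q^j \<ge> 2, and M \<ge> 1 makes powers of M increase
  with the exponent.\<close>

lemma alpha_bound:
  assumes M: "M \<ge> 1" "\<And>j. j \<le> r \<Longrightarrow> norm_le av M (coef j)"
  shows "norm_le av (M ^ (q ^ n - 1)) (alpha n)"
proof (induction n rule: less_induct)
  case (less n)
  show ?case
  proof (cases "n = 0")
    case True
    thus ?thesis by (simp add: alpha_0 norm_le_def mcoeff_one tone_def)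
  next
    case False
    have "norm_le av (M ^ (q ^ n - 1)) (coef j * mfrob q (int j) (alpha (n - j)))"
      if j: "j \<in> {1..min n r}" for j
    proof -
      have "norm_le av (M * (M ^ (q ^ (n - j) - 1)) ^ (q ^ j)) (coef j * mfrob q (int j) (alpha (n - j)))"
        using j by (intro norm_le_mult norm_le_mfrob M(2) less) auto
      moreover have "M * (M ^ (q ^ (n - j) - 1)) ^ (q ^ j) \<le> M ^ (q ^ n - 1)"
      proof -
        have "q ^ j \<ge> q ^ 1" using j q_ge_2 by (intro power_increasing) auto
        hence "q ^ j \<ge> 2" using q_ge_2 by simp
        moreover have "(q ^ (n - j) - 1) * q ^ j = q ^ n - q ^ j"
          using j by (simp add: diff_mult_distrib flip: power_add)
        moreover have "q ^ j \<le> q ^ n" using j q_ge_2 by (intro power_increasing) auto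
        ultimately have "Suc ((q ^ (n - j) - 1) * q ^ j) \<le> q ^ n - 1" by linarith
        hence "M ^ Suc ((q ^ (n - j) - 1) * q ^ j) \<le> M ^ (q ^ n - 1)"
          using M(1) by (rule power_increasing)
        thus ?thesis by (simp add: power_mult)
      qed
      ultimately show ?thesis by (rule norm_le_mono)
    qed
    moreover have "av (inverse (th ^ (q ^ n) - th)) \<le> 1"
    proof -
      let ?d = "th ^ (q ^ n) - th"
      have "av (inverse ?d) * av ?d = 1"
        using th_power_diff_nz[of n] False by (simp flip: av_mult)
      thus ?thesis using av_th_power_diff[of n] False
          mult_left_mono[of 1 "av ?d" "av (inverse ?d)"] by simp
    qed
    ultimately show ?thesis using False M(1)
      by (subst alpha.simps) (auto intro!: norm_le_mconst_mult norm_le_sum)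
  qed
qed

text \<open>The bound on alpha_i gives M^(q^i - 1) \<delta>^(q^i) = \<delta> (M \<delta>)^(q^i - 1),
  where M \<delta> \<le> 1/2 and q^i - 1 \<ge> i. This is the origin of the radius 1/(2M).\<close>

lemma small_term:
  assumes M: "M \<ge> 1" "\<And>j. j \<le> r \<Longrightarrow> norm_le av M (coef j)"
    and d: "norm_le av \<delta> d" "\<delta> \<le> 1 / (2 * M)"
  shows "norm_le av (\<delta> / 2 ^ i) (alpha i * mfrob q (int i) d)"
proof -
  have \<delta>: "\<delta> \<ge> 0" by (rule norm_le_nonneg[OF d(1)])
  have "q ^ i > 0" using q_ge_2 by simp
  then obtain k where k: "q ^ i = Suc k" by (metis gr0_implies_Suc)
  have "i < 2 ^ i" by (rule less_exp)
  also have "(2 :: nat) ^ i \<le> q ^ i" using q_ge_2 by (intro power_mono) auto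
  finally have ik: "i \<le> k" by (simp add: k)
  have "norm_le av (M ^ (q ^ i - 1) * \<delta> ^ (q ^ i)) (alpha i * mfrob q (int i) d)"
    by (intro norm_le_mult alpha_bound norm_le_mfrob M d(1))
  moreover have "M ^ (q ^ i - 1) * \<delta> ^ (q ^ i) = \<delta> * (M * \<delta>) ^ k"
    by (simp add: k power_mult_distrib)
  moreover have "(M * \<delta>) ^ k \<le> (1 / 2) ^ i"
  proof -
    have "M * \<delta> \<le> 1 / 2" using d(2) M(1) by (simp add: field_simps)
    hence "(M * \<delta>) ^ k \<le> (1 / 2) ^ k" using M(1) \<delta> by (intro power_mono) auto
    also have "\<dots> \<le> (1 / 2) ^ i" using ik by (intro power_decreasing) auto
    finally show ?thesis .
  qed
  hence "\<delta> * (M * \<delta>) ^ k \<le> \<delta> / 2 ^ i"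
    using mult_left_mono[OF _ \<delta>] by (fastforce simp: power_divide)
  ultimately show ?thesis using norm_le_mono by metis
qed

text \<open>Near 0 the exponential is the identity plus a contraction, so the equation is solved by
  iteration; the n-th step of the iteration only uses the first n terms of the series.\<close>

lemma exp_locally_surj: "\<exists>\<epsilon>>0. \<forall>g. tate av s (mcoeff g) \<longrightarrow> norm_le av \<epsilon> g \<longrightarrow>
  (\<exists>y. tate av s (mcoeff y) \<and> exp_tends y g)"
proof -
  obtain M where M: "M \<ge> 1" "\<And>j. j \<le> r \<Longrightarrow> norm_le av M (coef j)" using coef_bound by blast
  define \<epsilon> where "\<epsilon> = 1 / (2 * M)"
  have \<epsilon>: "\<epsilon> > 0" using M(1) by (simp add: \<epsilon>_def)
  have "\<exists>y. tate av s (mcoeff y) \<and> exp_tends y g"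
    if g: "tate av s (mcoeff g)" "norm_le av \<epsilon> g" for g
  proof -
    \<comment> \<open>The sum begins at 1: the term of index 0 is the identity, and \<open>T\<close>
      is the perturbation that must be a contraction.\<close>
    define T where "T = (\<lambda>n y. \<Sum>i\<in>{1..<n}. alpha i * mfrob q (int i) y)"
    have T_diff: "T n x - T n y = T n (x - y)" for n x y
      by (simp add: T_def mfrob_diff algebra_simps flip: sum_subtractf)
    have T_le: "norm_le av (\<delta> / 2) (T n x)" if "norm_le av \<delta> x" "\<delta> \<le> \<epsilon>" for n \<delta> x
      unfolding T_def
    proof (rule norm_le_sum)
      fix i assume i: "i \<in> {1..<n}"
      have "2 ^ 1 \<le> (2 :: real) ^ i" using i by (intro power_increasing) auto
      hence "\<delta> / 2 ^ i \<le> \<delta> / 2" using norm_le_nonneg[OF that(1)] by (intro divide_left_mono) auto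
      thus "norm_le av (\<delta> / 2) (alpha i * mfrob q (int i) x)"
        using small_term[OF M that(1), of i] that(2) by (auto simp: \<epsilon>_def intro: norm_le_mono)
    qed (use norm_le_nonneg[OF that(1)] in simp)
    define Y where "Y = rec_nat g (\<lambda>n y. g - T (Suc n) y)"
    have Y0: "Y 0 = g" and YS: "Y (Suc n) = g - T (Suc n) (Y n)" for n by (simp_all add: Y_def)
    have tate_Y: "tate av s (mcoeff (Y n))" for n
    proof (induction n)
      case (Suc n)
      show ?case unfolding YS T_def
        by (intro tate_diff g tate_sum tate_mult tate_alpha tate_mfrob Suc)
    qed (simp add: Y0 g)
    have Y_le: "norm_le av \<epsilon> (Y n)" for n
    proof (induction n)
      case (Suc n)
      have "norm_le av \<epsilon> (T (Suc n) (Y n))"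
        using T_le[OF Suc] by (rule norm_le_mono) (use \<epsilon> in auto)
      thus ?case unfolding YS by (intro norm_le_diff g)
    qed (simp add: Y0 g)
    have step: "norm_le av (\<epsilon> / 2 ^ n) (Y (Suc n) - Y n)" for n
    proof (induction n)
      case 0
      show ?case using \<epsilon> by (simp add: Y0 YS T_def)
    next
      case (Suc n)
      have le: "\<epsilon> / 2 ^ n \<le> \<epsilon>" using \<epsilon> by (simp add: field_simps)
      \<comment> \<open>Lengthening the truncation by one contributes a single new term, of index n
        + 1 and already of size \<epsilon> / 2^(n+1); the remaining part is the contraction applied
        to the previous increment.\<close>
      have "Y (Suc (Suc n)) - Y (Suc n) =
          - T (Suc n) (Y (Suc n) - Y n) - alpha (Suc n) * mfrob q (int (Suc n)) (Y (Suc n))"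
        unfolding YS[of "Suc n"] T_diff[symmetric] using YS[of n]
        by (simp add: T_def)
      moreover have "norm_le av (\<epsilon> / 2 ^ Suc n) (- T (Suc n) (Y (Suc n) - Y n))"
        using T_le[OF Suc le, of "Suc n"] by (simp add: norm_le_def field_simps)
      moreover have "norm_le av (\<epsilon> / 2 ^ Suc n) (alpha (Suc n) * mfrob q (int (Suc n)) (Y (Suc n)))"
        by (rule small_term[OF M Y_le]) (simp_all add: \<epsilon>_def)
      ultimately show ?case using norm_le_diff by metis
    qed
    have lim: "(\<lambda>n. \<epsilon> / 2 ^ n) \<longlonglongrightarrow> 0"
      using LIMSEQ_inverse_realpow_zero[of 2] tendsto_mult_right_zero[of "\<lambda>n. inverse (2 ^ n)" _ \<epsilon>]
      by (simp add: divide_inverse)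
    have "decseq (\<lambda>n. \<epsilon> / 2 ^ n)"
      using \<epsilon> by (intro decseq_SucI) (simp add: field_simps)
    from norm_le_complete[OF tate_Y step this lim] obtain y
      where y: "tate av s (mcoeff y)" "\<And>n. norm_le av (\<epsilon> / 2 ^ n) (Y n - y)" by blast
    have conv: "norm_le av (\<epsilon> / 2 ^ m) (exp_sum (Suc m) y - g)" for m
    proof -
      have "{..<Suc m} = insert 0 {1..<Suc m}" by auto
      hence "exp_sum (Suc m) y = y + T (Suc m) y"
        by (simp add: exp_sum_def T_def alpha_0)
      \<comment> \<open>Substitute g = Y (m+1) + T (m+1) (Y m), the defining equation of the
        iteration; both errors are then distances of iterates from their limit.\<close>
      hence "exp_sum (Suc m) y - g = - (Y (Suc m) - y) - T (Suc m) (Y m - y)"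
        unfolding T_diff[symmetric] YS by simp
      moreover have "norm_le av (\<epsilon> / 2 ^ m) (- (Y (Suc m) - y))"
      proof -
        have "norm_le av (\<epsilon> / 2 ^ m) (Y (Suc m) - y)"
          by (rule norm_le_mono[OF y(2)]) (use \<epsilon> in \<open>simp add: field_simps\<close>)
        thus ?thesis by (simp only: norm_le_def mcoeff_simps(4) av_uminus simp_thms)
      qed
      moreover have "norm_le av (\<epsilon> / 2 ^ m) (T (Suc m) (Y m - y))"
        by (rule norm_le_mono[OF T_le[OF y(2)]]) (use \<epsilon> in \<open>simp_all add: field_simps\<close>)
      ultimately show ?thesis using norm_le_diff by metis
    qed
    have "exp_tends y g" unfolding exp_tends_def
    proof (intro allI impI)
      fix e :: real assume "e > 0"
      then obtain N where N: "\<And>n. n \<ge> N \<Longrightarrow> \<epsilon> / 2 ^ n < e"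
        using order_tendstoD(2)[OF lim] unfolding eventually_sequentially by blast
      have "norm_le av e (exp_sum n y - g)" if "n \<ge> Suc N" for n
      proof -
        obtain m where m: "n = Suc m" "m \<ge> N"
          using \<open>n \<ge> Suc N\<close> by (cases n) auto
        show ?thesis unfolding m(1)
          by (rule norm_le_mono[OF conv]) (use N[OF m(2)] in simp)
      qed
      thus "\<exists>N. \<forall>n\<ge>N. norm_le av e (exp_sum n y - g)" by blast
    qed
    thus ?thesis using y(1) by blast
  qed
  thus ?thesis using \<epsilon> by blast
qed

text \<open>A finite form of exp theta = phi_theta exp. The j-th twist raises the degree in tau by
  j, so only n - j terms of the series at y enter there; truncated subtraction makes the sum empty
  for j > n.\<close>

lemma exp_sum_th:
  "exp_sum n (mconst th * y) = (\<Sum>j\<le>r. coef j * mfrob q (int j) (exp_sum (n - j) y))"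
proof (induction n)
  case (Suc n)
  have "exp_sum (Suc n) (mconst th * y) =
      exp_sum n (mconst th * y) + (alpha n * mconst (th ^ (q ^ n))) * mfrob q (int n) y"
    by (simp add: exp_sum_def mfrob_mult mfrob_mconst algebra_simps)
  also have "(alpha n * mconst (th ^ (q ^ n))) * mfrob q (int n) y =
      (\<Sum>j\<in>{0..min n r}. coef j * mfrob q (int j) (alpha (n - j) * mfrob q (int (n - j)) y))"
    unfolding alpha_rec sum_distrib_right
    by (intro sum.cong) (auto simp: mfrob_mult mfrob_mfrob mult.assoc)
  also have "\<dots> = (\<Sum>j\<le>r. if j \<le> n then coef j * mfrob q (int j) (alpha (n - j) * mfrob q (int (n - j)) y) else 0)"
    by (rule sum.mono_neutral_cong_left) auto
  also have "exp_sum n (mconst th * y) + \<dots> =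
      (\<Sum>j\<le>r. coef j * mfrob q (int j) (exp_sum (Suc n - j) y))"
    unfolding Suc.IH sum.distrib[symmetric]
    by (intro sum.cong) (auto simp: exp_sum_def Suc_diff_le mfrob_add algebra_simps)
  finally show ?case .
qed (simp add: exp_sum_def)

text \<open>Only finitely many twists occur in phi_theta, all with nonnegative exponent, so
  phi_theta is continuous and can be applied to the convergent partial sums at y.\<close>

lemma exp_tends_th:
  assumes "exp_tends y g"
  shows "exp_tends (mconst th * y) (phi g)"
  unfolding exp_tends_def
proof (intro allI impI)
  fix e :: real assume e: "e > 0"
  obtain M where M: "M \<ge> 1" "\<And>j. j \<le> r \<Longrightarrow> norm_le av M (coef j)" using coef_bound by blast
  \<comment> \<open>The cap 1 ensures \<delta>^(q^j) \<le> \<delta>, so that M \<delta> \<le> e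
    controls all summands at once.\<close>
  define \<delta> where "\<delta> = min 1 (e / M)"
  have \<delta>: "\<delta> > 0" "\<delta> \<le> 1" "M * \<delta> \<le> e"
    using e M(1) by (auto simp: \<delta>_def min_def field_simps)
  obtain N where N: "\<And>n. n \<ge> N \<Longrightarrow> norm_le av \<delta> (exp_sum n y - g)"
    using assms \<delta>(1) unfolding exp_tends_def by blast
  \<comment> \<open>With n \<ge> N + r all shifted indices n - j for j \<le> r are still at least
    N.\<close>
  have "norm_le av e (exp_sum n (mconst th * y) - phi g)" if n: "n \<ge> N + r" for n
  proof -
    have "exp_sum n (mconst th * y) - phi g = (\<Sum>j\<le>r. coef j * mfrob q (int j) (exp_sum (n - j) y - g))"
      unfolding exp_sum_th phi_def sum_subtractf[symmetric] by (simp add: mfrob_diff algebra_simps)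
    moreover have "norm_le av e (coef j * mfrob q (int j) (exp_sum (n - j) y - g))" if "j \<le> r" for j
    proof -
      have "norm_le av (M * \<delta> ^ (q ^ j)) (coef j * mfrob q (int j) (exp_sum (n - j) y - g))"
        using that n by (intro norm_le_mult norm_le_mfrob M(2) N) auto
      moreover have "\<delta> ^ (q ^ j) \<le> \<delta> ^ 1" using \<delta> q_ge_2 by (intro power_decreasing) auto
      hence "M * \<delta> ^ (q ^ j) \<le> M * \<delta>" using M(1) by (intro mult_left_mono) auto
      hence "M * \<delta> ^ (q ^ j) \<le> e" using \<delta>(3) by linarith
      ultimately show ?thesis by (rule norm_le_mono)
    qed
    ultimately show ?thesis using e by (auto intro!: norm_le_sum)
  qed
  thus "\<exists>N. \<forall>n\<ge>N. norm_le av e (exp_sum n (mconst th * y) - phi g)" by blast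
qed

lemma exp_surj_of_division_tower:
  assumes tate_G: "\<And>n. tate av s (mcoeff (G n))"
    and phi_G: "\<And>n. phi (G (Suc n)) = G n"
    and small: "\<And>e. e > 0 \<Longrightarrow> \<exists>n. norm_le av e (G n)"
  shows "\<exists>y. tate av s (mcoeff y) \<and> exp_tends y (G 0)"
proof -
  obtain \<epsilon> where \<epsilon>: "\<epsilon> > 0" "\<And>g. tate av s (mcoeff g) \<Longrightarrow> norm_le av \<epsilon> g \<Longrightarrow>
      \<exists>y. tate av s (mcoeff y) \<and> exp_tends y g"
    using exp_locally_surj by blast
  obtain n where n: "norm_le av \<epsilon> (G n)" using small \<epsilon>(1) by blast
  have "\<exists>y. tate av s (mcoeff y) \<and> exp_tends y (G n)" by (rule \<epsilon>(2)[OF tate_G n])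
  thus ?thesis
  proof (induction n)
    case (Suc n)
    then obtain y where "tate av s (mcoeff y)" "exp_tends y (G (Suc n))" by blast
    hence "tate av s (mcoeff (mconst th * y))" "exp_tends (mconst th * y) (G n)"
      using exp_tends_th[of y "G (Suc n)"] by (auto simp: phi_G intro!: tate_mult tate_mconst)
    thus ?case using Suc.IH by blast
  qed
qed

end

section \<open>Solving the twisted system\<close>

context C_infty
begin

text \<open>Up to sign the constant term is the product of the roots, so they cannot all have
  absolute value at least 1. The induction splits off a root: if it is not small, the constant term
  of the cofactor still is.\<close>

lemma monic_small_root:
  assumes "lead_coeff P = 1" "av (poly P 0) < 1"
  shows "\<exists>x. poly P x = 0 \<and> av x < 1"
  using assms
proof (induction "degree P" arbitrary: P)
  case 0
  then obtain c where "P = [:c:]" by (metis degree_eq_zeroE)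
  thus ?case using 0 by simp
next
  case (Suc n)
  then obtain x where x: "poly P x = 0" using alg_closed[of P] by auto
  then obtain Q where Q: "P = [:- x, 1:] * Q" by (auto simp: poly_eq_0_iff_dvd elim: dvdE)
  have "Q \<noteq> 0" using Suc.prems(1) Q by auto
  hence "degree P = Suc (degree Q)" unfolding Q by (subst degree_mult_eq) auto
  hence deg: "n = degree Q" using Suc.hyps(2) by simp
  have lc: "lead_coeff Q = 1" using Suc.prems(1) unfolding Q lead_coeff_mult by simp
  show ?case
  proof (cases "av x < 1")
    case False
    have "av (poly P 0) = av x * av (poly Q 0)" by (simp add: Q av_mult)
    moreover have "1 * av (poly Q 0) \<le> av x * av (poly Q 0)"
      using False by (intro mult_right_mono) auto
    ultimately have "av (poly Q 0) < 1" using Suc.prems(2) by simp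
    from Suc.hyps(1)[OF deg lc this] obtain w where "poly Q w = 0" "av w < 1" by blast
    thus ?thesis by (auto simp: Q)
  qed (use x in blast)
qed

text \<open>With x = y^q the equation becomes y^q - y = c. For |c| < 1 a root with |y| < 1 is taken;
  then |y^q| < |y| unless y = 0, so y = y^q - c forces |y| \<le> |c|, and x is smaller still. For
  |c| \<ge> 1 any root will do, because a series with coefficients tending to 0 has only finitely
  many such c.\<close>

lemma artin_schreier:
  "\<exists>x. x - frobk q (- 1) x = c \<and> (av c < 1 \<longrightarrow> av x \<le> av c)"
proof -
  define P where "P = monom 1 q + [:- c, - 1:]"
  have q: "q \<ge> 2" by (rule q_ge_2)
  have "degree P = degree (monom 1 q :: 'k poly)"
    unfolding P_def by (rule degree_add_eq_left) (use q in \<open>simp add: degree_monom_eq\<close>)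
  hence deg: "degree P = q" by (simp add: degree_monom_eq)
  have lc: "lead_coeff P = 1"
    unfolding deg using q by (cases q; cases "q - 1") (auto simp: P_def)
  have P: "poly P y = y ^ q - y - c" for y
    by (simp add: P_def poly_monom)
  have "\<exists>y. poly P y = 0 \<and> (av c < 1 \<longrightarrow> av y < 1)"
  proof (cases "av c < 1")
    case True
    hence "av (poly P 0) < 1" using q by (simp add: P power_0_left)
    thus ?thesis using monic_small_root[OF lc] by blast
  next
    case False
    thus ?thesis using alg_closed[of P] deg q by auto
  qed
  then obtain y where y: "y ^ q - y = c" "av c < 1 \<Longrightarrow> av y < 1" by (auto simp: P)
  have "frobk q (- 1) (y ^ q) = y"
    using frobk_iff[of 0 1 "y ^ q" y] by simp
  moreover have "av (y ^ q) \<le> av c" if "av c < 1"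
  proof (cases "y = 0")
    case False
    have "av (y ^ q) = av y ^ q" by (rule av_power)
    also have "av y ^ q < av y ^ 1"
      using y(2)[OF that] av_pos[OF False] q by (intro power_strict_decreasing) auto
    finally have "av (y ^ q) < av y" by simp
    moreover have "av y \<le> max (av (y ^ q)) (av c)"
      using av_diff[of "y ^ q" c] y(1) by (simp add: algebra_simps)
    ultimately show ?thesis by linarith
  qed (use q in \<open>simp add: power_0_left\<close>)
  ultimately show ?thesis using y(1) by (intro exI[of _ "y ^ q"]) simp
qed

text \<open>Convergence on the closed unit disc in z. The inverse twist takes q-th roots of norms
  and so destroys the weights q^i in \<open>Tz\<close>; norms tending to 0 are preserved by
  it.\<close>

definition zconv :: "'k mps fps \<Rightarrow> bool" where
  "zconv a \<longleftrightarrow> (\<forall>n. tate av s (mcoeff (a $ n))) \<and> (\<forall>e>0. \<exists>N. \<forall>n\<ge>N. norm_le av e (a $ n))"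

definition fps_frob :: "int \<Rightarrow> 'k mps fps \<Rightarrow> 'k mps fps" where
  "fps_frob n a = Abs_fps (\<lambda>k. mfrob q n (a $ k))"

lemma fps_frob_nth [simp]: "fps_frob n a $ k = mfrob q n (a $ k)"
  by (simp add: fps_frob_def)

lemma fps_frob_add: "fps_frob n (a + b) = fps_frob n a + fps_frob n b"
  by (simp add: fps_eq_iff mfrob_add)

lemma fps_frob_diff: "fps_frob n (a - b) = fps_frob n a - fps_frob n b"
  by (simp add: fps_eq_iff mfrob_diff)

lemma fps_frob_mult: "fps_frob n (a * b) = fps_frob n a * fps_frob n b"
  by (simp add: fps_eq_iff fps_mult_nth mfrob_sum mfrob_mult)

lemma fps_frob_fps_frob: "fps_frob m (fps_frob n a) = fps_frob (m + n) a"
  by (simp add: fps_eq_iff mfrob_mfrob)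

lemma fps_frob_const: "fps_frob n (fps_const c) = fps_const (mfrob q n c)"
  by (simp add: fps_eq_iff)

lemma fps_frob_0 [simp]: "fps_frob 0 a = a"
  by (simp add: fps_eq_iff)

lemma zconv_const: "tate av s (mcoeff c) \<Longrightarrow> zconv (fps_const c)"
  unfolding zconv_def by (auto intro!: exI[of _ 1])

lemma zconv_add:
  assumes "zconv a" "zconv b"
  shows "zconv (a + b)"
  unfolding zconv_def
proof (intro conjI allI impI)
  show "tate av s (mcoeff ((a + b) $ n))" for n
    using assms unfolding fps_add_nth zconv_def by (intro tate_add) auto
  fix e :: real assume "e > 0"
  then obtain M N where "\<And>n. n \<ge> M \<Longrightarrow> norm_le av e (a $ n)" "\<And>n. n \<ge> N \<Longrightarrow> norm_le av e (b $ n)"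
    using assms unfolding zconv_def by meson
  thus "\<exists>N. \<forall>n\<ge>N. norm_le av e ((a + b) $ n)"
    by (intro exI[of _ "max M N"]) (simp add: norm_le_add)
qed

lemma zconv_bounded:
  assumes "zconv a"
  shows "\<exists>C. \<forall>n. norm_le av C (a $ n)"
proof -
  obtain N where N: "\<And>n. n \<ge> N \<Longrightarrow> norm_le av 1 (a $ n)"
    using assms unfolding zconv_def by (meson zero_less_one)
  have "\<exists>C. norm_le av C (a $ n)" for n
    using tate_bounded[of "a $ n"] assms unfolding zconv_def by simp
  then obtain C where C: "\<And>n. norm_le av (C n) (a $ n)" by metis
  have "norm_le av (1 + (\<Sum>i<N. \<bar>C i\<bar>)) (a $ n)" for n
  proof (cases "n < N")
    case True
    hence "\<bar>C n\<bar> \<le> (\<Sum>i<N. \<bar>C i\<bar>)" by (intro member_le_sum) auto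
    thus ?thesis by (intro norm_le_mono[OF C]) linarith
  next
    case False
    hence "norm_le av 1 (a $ n)" using N by simp
    thus ?thesis by (rule norm_le_mono) (simp add: sum_nonneg)
  qed
  thus ?thesis by blast
qed

lemma zconv_mult:
  assumes "zconv a" "zconv b"
  shows "zconv (a * b)"
  unfolding zconv_def
proof (intro conjI allI impI)
  show "tate av s (mcoeff ((a * b) $ n))" for n
    unfolding fps_mult_nth using assms unfolding zconv_def by (intro tate_sum tate_mult) auto
  fix e :: real assume e: "e > 0"
  obtain C D where C: "\<And>n. norm_le av C (a $ n)" and D: "\<And>n. norm_le av D (b $ n)"
    using zconv_bounded assms by meson
  define B where "B = max 1 (max C D)"
  have B: "B > 0" "norm_le av B (a $ n)" "norm_le av B (b $ n)" for n
    by (auto simp: B_def intro: norm_le_mono[OF C] norm_le_mono[OF D])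
  have "e / B > 0" using e B(1) by simp
  then obtain M N where M: "\<And>n. n \<ge> M \<Longrightarrow> norm_le av (e / B) (a $ n)"
    and N: "\<And>n. n \<ge> N \<Longrightarrow> norm_le av (e / B) (b $ n)"
    using assms unfolding zconv_def by meson
  have "norm_le av e ((a * b) $ n)" if n: "n \<ge> M + N" for n
    unfolding fps_mult_nth
  proof (rule norm_le_sum)
    fix i assume "i \<in> {0..n}"
    show "norm_le av e (a $ i * b $ (n - i))"
    proof (cases "i \<ge> M")
      case True
      thus ?thesis using norm_le_mult[OF M[OF True] B(3)] B(1) by simp
    next
      case False
      hence "n - i \<ge> N" using n by simp
      thus ?thesis using norm_le_mult[OF B(2) N] B(1) by simp
    qed
  qed (use e in simp)
  thus "\<exists>N. \<forall>n\<ge>N. norm_le av e ((a * b) $ n)" by blast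
qed

lemma zconv_sum: "(\<And>x. x \<in> S \<Longrightarrow> zconv (f x)) \<Longrightarrow> zconv (sum f S)"
proof (induction S rule: infinite_finite_induct)
  case (insert x S)
  thus ?case by (simp add: zconv_add)
qed (simp_all add: zconv_def)

lemma zconv_fps_frob:
  assumes "zconv a"
  shows "zconv (fps_frob n a)"
  unfolding zconv_def
proof (intro conjI allI impI)
  show "tate av s (mcoeff (fps_frob n a $ k))" for k
    using assms unfolding zconv_def fps_frob_nth by (intro tate_mfrob) auto
  fix e :: real assume "e > 0"
  from frobk_small[OF this] obtain d where d: "d > 0" "\<And>x. av x < d \<Longrightarrow> av (frobk q n x) < e"
    by blast
  hence "d / 2 > 0" by simp
  then obtain N where N: "\<And>k. k \<ge> N \<Longrightarrow> norm_le av (d / 2) (a $ k)"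
    using assms unfolding zconv_def by meson
  have "norm_le av e (fps_frob n a $ k)" if "k \<ge> N" for k
    unfolding norm_le_def fps_frob_nth mcoeff_mfrob
  proof
    fix \<nu>
    have "av (mcoeff (a $ k) \<nu>) \<le> d / 2" using N[OF that] by (simp add: norm_le_def)
    hence "av (mcoeff (a $ k) \<nu>) < d" using d(1) by simp
    from d(2)[OF this] show "av (frobk q n (mcoeff (a $ k) \<nu>)) \<le> e" by simp
  qed
  thus "\<exists>N. \<forall>k\<ge>N. norm_le av e (fps_frob n a $ k)" by blast
qed

text \<open>Both the twist and the equation act on each coefficient in t and z separately, so scalar
  solutions are chosen coefficient by coefficient.\<close>

lemma zconv_artin_schreier:
  assumes "zconv b"
  shows "\<exists>u. zconv u \<and> u - fps_frob (- 1) u = b"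
proof -
  obtain X where X: "\<And>c. X c - frobk q (- 1) (X c) = c" "\<And>c. av c < 1 \<Longrightarrow> av (X c) \<le> av c"
    using artin_schreier by metis
  \<comment> \<open>At c = 0 every element of F_q is a solution; the size bound selects 0. Without
    this the solution would not keep the support of b.\<close>
  have X0: "X 0 = 0" using X(2)[of 0] av_pos[of "X 0"] by fastforce
  define u where "u = Abs_fps (\<lambda>n. Mps (\<lambda>\<nu>. X (mcoeff (b $ n) \<nu>)))"
  have u: "mcoeff (u $ n) \<nu> = X (mcoeff (b $ n) \<nu>)" for n \<nu>
    unfolding u_def fps_nth_Abs_fps by (subst mcoeff_Mps) (simp_all add: mcoeff_infinite X0)
  have "u - fps_frob (- 1) u = b"
    by (rule fps_ext, rule mps_eqI) (simp add: u X)
  moreover have "zconv u" unfolding zconv_def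
  proof (intro conjI allI impI)
    fix n
    have b: "tate av s (mcoeff (b $ n))" using assms by (simp add: zconv_def)
    have "finite {\<nu>. av (mcoeff (u $ n) \<nu>) \<ge> e}" if "e > 0" for e
    proof -
      \<comment> \<open>Where |c| \<ge> 1 the solution is not controlled; the threshold min e 1
        captures those exponents too.\<close>
      have "{\<nu>. av (mcoeff (u $ n) \<nu>) \<ge> e} \<subseteq> {\<nu>. av (mcoeff (b $ n) \<nu>) \<ge> min e 1}"
      proof safe
        fix \<nu> assume e: "av (mcoeff (u $ n) \<nu>) \<ge> e"
        show "av (mcoeff (b $ n) \<nu>) \<ge> min e 1"
        proof (cases "av (mcoeff (b $ n) \<nu>) < 1")
          case True
          from X(2)[OF this] e show ?thesis by (simp add: u)
        qed simp
      qed
      moreover have "finite {\<nu>. av (mcoeff (b $ n) \<nu>) \<ge> min e 1}"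
        using that by (intro tate_finite[OF b]) simp
      ultimately show ?thesis by (rule finite_subset)
    qed
    thus "tate av s (mcoeff (u $ n))"
      using b X0 unfolding tate_def u by metis
  next
    fix e :: real assume "e > 0"
    \<comment> \<open>The cap 1/2 keeps the coefficients of b strictly below 1, where the size bound
      on X applies.\<close>
    hence "min e (1 / 2) > 0" by simp
    then obtain N where N: "\<And>n. n \<ge> N \<Longrightarrow> norm_le av (min e (1 / 2)) (b $ n)"
      using assms unfolding zconv_def by meson
    have "norm_le av e (u $ n)" if "n \<ge> N" for n
      unfolding norm_le_def u
    proof
      fix \<nu>
      have *: "av (mcoeff (b $ n) \<nu>) \<le> min e (1 / 2)" using N[OF that] by (simp add: norm_le_def)
      hence "av (mcoeff (b $ n) \<nu>) < 1" by simp
      from X(2)[OF this] * show "av (X (mcoeff (b $ n) \<nu>)) \<le> e" by simp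
    qed
    thus "\<exists>N. \<forall>n\<ge>N. norm_le av e (u $ n)" by blast
  qed
  ultimately show ?thesis by blast
qed

end

section \<open>Linear systems over a ring with an endomorphism\<close>

lemma row_times_inverse:
  fixes M N :: "nat \<Rightarrow> nat \<Rightarrow> 'a::comm_ring_1"
  assumes "\<And>i j. i < r \<Longrightarrow> j < r \<Longrightarrow> (\<Sum>k<r. M i k * N k j) = (if i = j then 1 else 0)" and "l < r"
  shows "(\<Sum>j<r. (\<Sum>i<r. c i * M i j) * N j l) = c l"
proof -
  have "(\<Sum>j<r. (\<Sum>i<r. c i * M i j) * N j l) = (\<Sum>i<r. c i * (\<Sum>j<r. M i j * N j l))"
    unfolding sum_distrib_left sum_distrib_right by (subst sum.swap) (simp add: mult.assoc)
  also have "\<dots> = (\<Sum>i<r. if i = l then c i else 0)"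
    using assms by (intro sum.cong) auto
  finally show ?thesis using assms(2) by simp
qed

text \<open>Multiplying by a solution P of sigma(P) = F P turns the inhomogeneous system
  y = sigma(y) F + (f, 0, ..., 0) into the diagonal system u - sigma(u) = f P_0 for u = y P.\<close>

lemma diagonalize_system:
  fixes P Q F :: "nat \<Rightarrow> nat \<Rightarrow> 'a::comm_ring_1"
  assumes add: "\<And>a b. \<sigma> (a + b) = \<sigma> a + \<sigma> b" and mult: "\<And>a b. \<sigma> (a * b) = \<sigma> a * \<sigma> b"
    and PQ: "\<And>i j. i < r \<Longrightarrow> j < r \<Longrightarrow> (\<Sum>k<r. P i k * Q k j) = (if i = j then 1 else 0)"
    and QP: "\<And>i j. i < r \<Longrightarrow> j < r \<Longrightarrow> (\<Sum>k<r. Q i k * P k j) = (if i = j then 1 else 0)"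
    and FP: "\<And>i j. i < r \<Longrightarrow> j < r \<Longrightarrow> \<sigma> (P i j) = (\<Sum>k<r. F i k * P k j)"
    and u: "\<And>j. j < r \<Longrightarrow> u j - \<sigma> (u j) = f * P 0 j"
    and y: "\<And>i. i < r \<Longrightarrow> y i = (\<Sum>k<r. u k * Q k i)"
    and l: "l < r"
  shows "y l = (\<Sum>k<r. \<sigma> (y k) * F k l) + (if l = 0 then f else 0)"
proof -
  have \<sigma>0: "\<sigma> 0 = 0" using add[of 0 0] by simp
  have \<sigma>_sum: "\<sigma> (sum g S) = (\<Sum>x\<in>S. \<sigma> (g x))" for g :: "nat \<Rightarrow> 'a" and S
    by (induction S rule: infinite_finite_induct) (auto simp: add \<sigma>0)
  have uy: "u j = (\<Sum>i<r. y i * P i j)" if "j < r" for j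
    using row_times_inverse[where M = Q and N = P and c = u, OF QP that] by (simp add: y)
  \<comment> \<open>The row y \<sigma>-twisted and multiplied by F. By \<sigma>(P) = F P,
    multiplying y - w by P gives u - \<sigma>(u), and Q then cancels P.\<close>
  define w where "w = (\<lambda>i. \<Sum>k<r. \<sigma> (y k) * F k i)"
  have "(\<Sum>i<r. (y i - w i) * P i j) = f * P 0 j" if j: "j < r" for j
  proof -
    have "(\<Sum>i<r. w i * P i j) = (\<Sum>k<r. \<sigma> (y k) * (\<Sum>i<r. F k i * P i j))"
      unfolding w_def sum_distrib_left sum_distrib_right by (subst sum.swap) (simp add: mult.assoc)
    also have "\<dots> = \<sigma> (u j)"
      using j by (simp add: uy \<sigma>_sum mult FP)
    finally have "(\<Sum>i<r. w i * P i j) = \<sigma> (u j)" .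
    hence "(\<Sum>i<r. (y i - w i) * P i j) = u j - \<sigma> (u j)"
      using uy[OF j] by (simp add: sum_subtractf algebra_simps)
    thus ?thesis using u[OF j] by simp
  qed
  hence "(\<Sum>j<r. (\<Sum>i<r. (y i - w i) * P i j) * Q j l) = (\<Sum>j<r. f * P 0 j * Q j l)"
    by simp
  also have "\<dots> = (if l = 0 then f else 0)"
    using PQ[of 0 l] l by (simp add: mult.assoc flip: sum_distrib_left)
  finally have "y l - w l = (if l = 0 then f else 0)"
    using row_times_inverse[where M = P and N = Q and c = "\<lambda>i. y i - w i", OF PQ l] by simp
  thus ?thesis by (simp add: w_def algebra_simps)
qed

section \<open>Translation of raw z-series and matrices into formal power series\<close>

definition zser_fps :: "'k::field zser \<Rightarrow> 'k mps fps" where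
  "zser_fps a = Abs_fps (\<lambda>n. Mps (a n))"

text \<open>Coefficient functions that are nonzero on an exponent of infinite support are not
  represented faithfully by Mps.\<close>

definition zreg :: "'k::field zser \<Rightarrow> bool" where
  "zreg a \<longleftrightarrow> (\<forall>n. mcoeff (Mps (a n)) = a n)"

lemma zser_fps_nth [simp]: "zser_fps a $ n = Mps (a n)"
  by (simp add: zser_fps_def)

lemma zmul_eq:
  assumes "zreg a" "zreg b"
  shows "zmul a b n \<nu> = mcoeff ((zser_fps a * zser_fps b) $ n) \<nu>"
  using assms unfolding zreg_def
  by (simp add: zmul_def fps_mult_nth mcoeff_sum mcoeff_times atMost_atLeast0)

lemma zser_fps_zmatmul:
  assumes "\<And>k. k < r \<Longrightarrow> zreg (M i k)" "\<And>k. k < r \<Longrightarrow> zreg (N k j)"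
  shows "zser_fps (zmatmul r M N i j) = (\<Sum>k<r. zser_fps (M i k) * zser_fps (N k j))"
proof (rule fps_ext)
  fix n
  have "zmatmul r M N i j n = mcoeff ((\<Sum>k<r. zser_fps (M i k) * zser_fps (N k j)) $ n)"
    using assms by (simp add: fun_eq_iff zmatmul_def fps_sum_nth mcoeff_sum zmul_eq)
  thus "zser_fps (zmatmul r M N i j) $ n = (\<Sum>k<r. zser_fps (M i k) * zser_fps (N k j)) $ n"
    by (simp add: mcoeff_inverse)
qed

lemma Mps_tzero: "Mps tzero = 0"
  by (simp add: zero_mps_def tzero_def)

lemma Mps_tone: "Mps tone = 1"
  by (simp add: one_mps_def)

lemma zser_fps_zid: "zser_fps (zid i j) = (if i = j then 1 else 0)"
  by (simp add: fps_eq_iff zid_def zone_def zzero_def Mps_tzero Mps_tone)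

context C_infty
begin

lemma zser_fps_zfrob: "zreg a \<Longrightarrow> zser_fps (zfrob q n a) = fps_frob n (zser_fps a)"
  by (simp add: fps_eq_iff zfrob_def mfrob_def zreg_def)

lemma Tz_zreg: "Tz av q s a \<Longrightarrow> zreg a"
  unfolding Tz_def zreg_def using mcoeff_Mps_tate by blast

lemma Tz_zconv:
  assumes "Tz av q s a"
  shows "zconv (zser_fps a)"
proof -
  have T: "tate av s (a n)" for n using assms by (simp add: Tz_def)
  have lim: "(\<lambda>i. real q ^ i * gnorm av (a i)) \<longlonglongrightarrow> 0" using assms by (simp add: Tz_def)
  show ?thesis unfolding zconv_def
  proof (intro conjI allI impI)
    show "tate av s (mcoeff (zser_fps a $ n))" for n
      using T[of n] mcoeff_Mps_tate[OF T] by simp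
    fix e :: real assume "e > 0"
    then obtain N where N: "\<And>n. n \<ge> N \<Longrightarrow> real q ^ n * gnorm av (a n) < e"
      using order_tendstoD(2)[OF lim] unfolding eventually_sequentially by blast
    have "norm_le av e (zser_fps a $ n)" if "n \<ge> N" for n
    proof -
      have le: "norm_le av (gnorm av (a n)) (Mps (a n))" by (rule norm_le_gnorm[OF T])
      have "1 * gnorm av (a n) \<le> real q ^ n * gnorm av (a n)"
        using norm_le_nonneg[OF le] q_ge_2 by (intro mult_right_mono one_le_power) auto
      thus ?thesis using norm_le_mono[OF le] N[OF that] by simp
    qed
    thus "\<exists>N. \<forall>n\<ge>N. norm_le av e (zser_fps a $ n)" by blast
  qed
qed

end

section \<open>The companion matrix and the division tower\<close>

context drinfeld
begin

text \<open>The twist is multiplicative, so it carries an inverse of A_r to an inverse of its twist;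
  uniqueness of inverses in a commutative ring evaluates the definite description in
  \<open>tinv\<close>.\<close>

lemma tinv_frob_leading:
  assumes "r \<ge> 1" "tunit av s (A r)"
  defines "d \<equiv> tinv av s (tfrob q (- int r) (A r))"
  shows "tate av s d" "mfrob q (- int r) (coef r) * Mps d = 1"
proof -
  define x where "x = mfrob q (- int r) (coef r)"
  have coef: "mcoeff (coef r) = A r" using assms(1) by (simp add: mcoeff_coef phi_coeff_def)
  have x: "mcoeff x = tfrob q (- int r) (A r)" unfolding x_def mcoeff_mfrob_raw coef ..
  obtain g where g: "tate av s g" "tmul (A r) g = tone" using assms(2) by (auto simp: tunit_def)
  define y where "y = mfrob q (- int r) (Mps g)"
  have "mcoeff (coef r * Mps g) = mcoeff 1"
    by (simp add: mcoeff_times coef mcoeff_Mps_tate[OF g(1)] g(2) mcoeff_one)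
  hence "coef r * Mps g = 1" by (simp add: mcoeff_inject)
  hence xy: "x * y = 1" unfolding x_def y_def mfrob_mult[symmetric] by simp
  have ty: "tate av s (mcoeff y)"
    unfolding y_def by (intro tate_mfrob) (simp add: mcoeff_Mps_tate[OF g(1)] g(1))
  have "d = mcoeff y" unfolding d_def tinv_def
  proof (rule the_equality)
    show "tate av s (mcoeff y) \<and> tmul (tfrob q (- int r) (A r)) (mcoeff y) = tone"
      using ty xy by (metis mcoeff_one mcoeff_times x)
    fix h assume h: "tate av s h \<and> tmul (tfrob q (- int r) (A r)) h = tone"
    hence "mcoeff (Mps h) = h" by (intro mcoeff_Mps_tate) blast
    hence "mcoeff (x * Mps h) = mcoeff 1"
      using h by (simp add: mcoeff_times x mcoeff_one)
    hence xh: "x * Mps h = 1" by (simp add: mcoeff_inject)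
    have "Mps h = (x * y) * Mps h" by (simp add: xy)
    also have "\<dots> = y * (x * Mps h)" by (simp only: mult_ac)
    finally have "Mps h = y" by (simp add: xh)
    thus "h = mcoeff y" using h mcoeff_Mps_tate by metis
  qed
  thus "tate av s d" "mfrob q (- int r) (coef r) * Mps d = 1"
    using ty xy by (simp_all add: x_def mcoeff_inverse)
qed

lemma Phi_mat_fps:
  assumes "r \<ge> 1" "tunit av s (A r)" "i < r" "j < r"
  defines "d \<equiv> tinv av s (tfrob q (- int r) (A r))"
  shows "zreg (Phi_mat av q s th r A i j)" (is ?reg)
    and "zser_fps (Phi_mat av q s th r A i j) =
     (if i + 1 < r then (if j = i + 1 then 1 else 0)
      else if j = 0 then fps_const (Mps d) * (fps_X - fps_const (mconst th))
      else - (fps_const (Mps d) * fps_const (mfrob q (- int j) (coef j))))" (is ?eq)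
proof -
  have d: "mcoeff (Mps d) = d"
    unfolding d_def by (rule mcoeff_Mps_tate[OF tinv_frob_leading(1)[OF assms(1,2)]])
  have zero: "mcoeff (Mps tzero) = (tzero :: 'k tate)" and one: "mcoeff (Mps tone) = (tone :: 'k tate)"
    by (simp_all add: Mps_tzero Mps_tone mcoeff_one) (simp add: tzero_def fun_eq_iff)
  have th: "tmul (tconst (- th)) d = mcoeff (mconst (- th) * Mps d)"
    by (simp add: mcoeff_times mcoeff_mconst d)
  have last: "tmul (\<lambda>\<nu>. - tfrob q (- int j) (A j) \<nu>) d = mcoeff (- mfrob q (- int j) (coef j) * Mps d)"
    if "j \<noteq> 0"
  proof -
    have "mcoeff (coef j) = A j" using that \<open>j < r\<close> by (simp add: mcoeff_coef phi_coeff_def)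
    hence "(\<lambda>\<nu>. - tfrob q (- int j) (A j) \<nu>) = mcoeff (- mfrob q (- int j) (coef j))"
      by (simp add: fun_eq_iff tfrob_def)
    thus ?thesis by (simp only: mcoeff_times d)
  qed
  show ?reg
    using zero one d last unfolding Phi_mat_def zreg_def d_def[symmetric] Let_def th
    by (auto simp: zone_def zzero_def zconst_def mcoeff_inverse)
  show ?eq
    using last unfolding Phi_mat_def d_def[symmetric] Let_def th
    by (auto simp: fps_eq_iff zone_def zzero_def zconst_def mcoeff_inverse Mps_tzero Mps_tone
        mconst_uminus mult.commute)
qed

text \<open>The columns of the companion matrix express y_(i+1) through the twist of y_i and g
  alone. Twisting the i-th relation back to level 0 makes the y_i telescope, leaving a single
  equation in g.\<close>

lemma division_tower_of_trivialization:
  assumes r: "r \<ge> 1" and unit: "tunit av s (A r)"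
    and \<Psi>: "rigid_analytic_trivialization av q s th r A \<Psi>"
    and f: "tate av s (mcoeff f)"
  shows "\<exists>g. zconv g \<and> phi (g $ 0) = f \<and> (\<forall>n. phi (g $ Suc n) = g $ n)"
proof -
  have GL: "in_GL av q s r \<Psi>"
    using \<Psi> by (simp add: rigid_analytic_trivialization_def)
  then obtain N where N: "\<forall>i<r. \<forall>j<r. Tz av q s (N i j)"
      "\<forall>i<r. \<forall>j<r. zmatmul r \<Psi> N i j = zid i j \<and> zmatmul r N \<Psi> i j = zid i j"
    unfolding in_GL_def by (elim conjE exE)
  have T: "Tz av q s (\<Psi> i j)" "Tz av q s (N i j)" if "i < r" "j < r" for i j
    using GL N(1) that by (simp_all add: in_GL_def)
  have inv: "zmatmul r \<Psi> N i j = zid i j" "zmatmul r N \<Psi> i j = zid i j" if "i < r" "j < r" for i j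
    using N(2) that by simp_all
  have eq: "zfrob q (- 1) (\<Psi> i j) = zmatmul r (Phi_mat av q s th r A) \<Psi> i j" if "i < r" "j < r" for i j
    using \<Psi> that by (simp add: rigid_analytic_trivialization_def)
  define P where "P = (\<lambda>i j. zser_fps (\<Psi> i j))"
  define Q where "Q = (\<lambda>i j. zser_fps (N i j))"
  define F where "F = (\<lambda>i j. zser_fps (Phi_mat av q s th r A i j))"
  have PQ: "(\<Sum>k<r. P i k * Q k j) = (if i = j then 1 else 0)" if "i < r" "j < r" for i j
    unfolding P_def Q_def using that zser_fps_zmatmul[of r \<Psi> i N j] inv(1)
    by (simp add: T Tz_zreg zser_fps_zid)
  have QP: "(\<Sum>k<r. Q i k * P k j) = (if i = j then 1 else 0)" if "i < r" "j < r" for i j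
    unfolding P_def Q_def using that zser_fps_zmatmul[of r N i \<Psi> j] inv(2)
    by (simp add: T Tz_zreg zser_fps_zid)
  have FP: "fps_frob (- 1) (P i j) = (\<Sum>k<r. F i k * P k j)" if "i < r" "j < r" for i j
  proof -
    have "fps_frob (- 1) (P i j) = zser_fps (zfrob q (- 1) (\<Psi> i j))"
      unfolding P_def using that by (simp add: zser_fps_zfrob T Tz_zreg)
    also have "\<dots> = (\<Sum>k<r. F i k * P k j)"
      unfolding eq[OF that] P_def F_def using that
      by (intro zser_fps_zmatmul) (auto intro: Tz_zreg T Phi_mat_fps(1)[OF r unit])
    finally show ?thesis .
  qed
  have "\<exists>u. zconv u \<and> u - fps_frob (- 1) u = fps_const f * P 0 j" if "j < r" for j
    using that r unfolding P_def
    by (intro zconv_artin_schreier zconv_mult zconv_const f Tz_zconv T) auto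
  then obtain u where u: "\<And>j. j < r \<Longrightarrow> zconv (u j)"
      "\<And>j. j < r \<Longrightarrow> u j - fps_frob (- 1) (u j) = fps_const f * P 0 j"
    by metis
  define y where "y = (\<lambda>i. \<Sum>k<r. u k * Q k i)"
  have zy: "zconv (y i)" if "i < r" for i
    unfolding y_def Q_def using that by (intro zconv_sum zconv_mult u Tz_zconv T) auto
  have sys: "y l = (\<Sum>k<r. fps_frob (- 1) (y k) * F k l) + (if l = 0 then fps_const f else 0)"
    if "l < r" for l
    by (rule diagonalize_system[OF fps_frob_add fps_frob_mult PQ QP FP u(2) _ that])
      (simp_all add: y_def)
  define d where "d = Mps (tinv av s (tfrob q (- int r) (A r)))"
  note d_props = tinv_frob_leading[OF r unit]
  \<comment> \<open>Indices start at 0, so y (r - 1) is the last component. The product of its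
    inverse twist with 1/A_r^(-r) is the factor shared by all contributions of the last row of
    Phi.\<close>
  define g where "g = fps_const d * fps_frob (- 1) (y (r - 1))"
  have zg: "zconv g"
    unfolding g_def d_def using r d_props(1)
    by (intro zconv_mult zconv_const zconv_fps_frob zy) (auto simp: mcoeff_Mps_tate)
  have F: "F i j = (if i + 1 < r then (if j = i + 1 then 1 else 0)
      else if j = 0 then fps_const d * (fps_X - fps_const (mconst th))
      else - (fps_const d * fps_const (mfrob q (- int j) (coef j))))" if "i < r" "j < r" for i j
    unfolding F_def d_def by (rule Phi_mat_fps(2)[OF r unit that])
  obtain m where m: "r = Suc m" using r by (cases r) auto
  \<comment> \<open>A column of Phi meets at most one superdiagonal entry 1 besides its entry in the
    last row, of index m = r - 1.\<close>
  have split: "(\<Sum>k<r. fps_frob (- 1) (y k) * F k l) =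
      (\<Sum>k<m. if l = Suc k then fps_frob (- 1) (y k) else 0) + fps_frob (- 1) (y m) * F m l"
    if "l < r" for l
  proof -
    have "(\<Sum>k<m. fps_frob (- 1) (y k) * F k l) = (\<Sum>k<m. if l = Suc k then fps_frob (- 1) (y k) else 0)"
      using that by (intro sum.cong) (auto simp: F m)
    thus ?thesis by (simp add: m)
  qed
  have y0: "y 0 = g * (fps_X - fps_const (mconst th)) + fps_const f"
    using sys[of 0] split[of 0] r by (simp add: F m g_def mult_ac)
  have yS: "y (Suc i) = fps_frob (- 1) (y i) - fps_const (mfrob q (- int (Suc i)) (coef (Suc i))) * g"
    if i: "Suc i < r" for i
  proof -
    have "(\<Sum>k<m. if Suc i = Suc k then fps_frob (- 1) (y k) else 0) = fps_frob (- 1) (y i)"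
      using i by (simp add: m)
    hence "y (Suc i) = fps_frob (- 1) (y i) + fps_frob (- 1) (y m) * F m (Suc i)"
      using sys[OF i] split[OF i] by simp
    also have "F m (Suc i) = - (fps_const d * fps_const (mfrob q (- int (Suc i)) (coef (Suc i))))"
      using F[of m "Suc i"] i by (simp only: m if_False nat.distinct) simp
    finally show ?thesis
      unfolding g_def m by (simp del: fps_const_mult fps_const_neg add: mult_ac)
  qed
  \<comment> \<open>Applying the (i+1)-st twist to \<open>yS\<close> removes all negative twists:
    y_(i+1)^(i+1) = y_i^(i) - A_(i+1) g^(i+1).\<close>
  have y0': "y 0 = fps_frob (int i) (y i) + (\<Sum>j\<in>{1..i}. fps_const (coef j) * fps_frob (int j) g)"
    if "i < r" for i
    using that
  proof (induction i)
    case (Suc i)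
    have "fps_frob (int (Suc i)) (y (Suc i)) =
        fps_frob (int i) (y i) - fps_const (coef (Suc i)) * fps_frob (int (Suc i)) g"
      unfolding yS[OF Suc.prems]
      by (simp add: fps_frob_diff fps_frob_mult fps_frob_const fps_frob_fps_frob mfrob_mfrob)
    thus ?case using Suc by simp
  qed simp
  \<comment> \<open>The definition of g supplies the missing term j = r: A_r g^(r) equals the
    remainder y_(r-1)^(r-1) in the telescoped sum.\<close>
  have "fps_const (mfrob q (- int r) (coef r)) * fps_const d = 1"
    using d_props(2) by (simp add: d_def)
  hence "fps_const (mfrob q (- int r) (coef r)) * g = fps_frob (- 1) (y m)"
    unfolding g_def m by (simp add: mult.assoc[symmetric])
  hence "fps_frob (int r) (fps_const (mfrob q (- int r) (coef r)) * g) = fps_frob (int r) (fps_frob (- 1) (y m))"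
    by simp
  hence "fps_const (coef r) * fps_frob (int r) g = fps_frob (int m) (y m)"
    by (simp add: m fps_frob_mult fps_frob_const fps_frob_fps_frob mfrob_mfrob)
  hence "y 0 = (\<Sum>j\<in>{1..r}. fps_const (coef j) * fps_frob (int j) g)"
    using y0'[of m] by (simp add: m add.commute)
  moreover have "{..r} = insert 0 {1..r}" by auto
  hence "(\<Sum>j\<le>r. fps_const (coef j) * fps_frob (int j) g) =
      fps_const (mconst th) * g + (\<Sum>j\<in>{1..r}. fps_const (coef j) * fps_frob (int j) g)"
    by (simp add: coef_0)
  ultimately have "(\<Sum>j\<le>r. fps_const (coef j) * fps_frob (int j) g) = fps_X * g + fps_const f"
    using y0 by (simp add: algebra_simps)
  \<comment> \<open>Twists act coefficientwise in z, so phi_theta does too, while multiplication by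
    z shifts the coefficients.\<close>
  hence "phi (g $ n) = (fps_X * g + fps_const f) $ n" for n
    by (simp add: phi_def fps_sum_nth fps_eq_iff)
  hence "phi (g $ 0) = f" "phi (g $ Suc n) = g $ n" for n by simp_all
  thus ?thesis using zg by blast
qed

end

section \<open>Surjectivity of the exponential from the division tower\<close>

theorem theorem4p11:
  fixes av :: "'k::field \<Rightarrow> real" and p q s r :: nat and th :: 'k
    and A :: "nat \<Rightarrow> 'k tate"
  assumes "C_infty_field av p q th"
    and "r \<ge> 1"
    and "\<forall>i\<in>{1..r}. tate av s (A i)"
    and "tunit av s (A r)"
    and "\<exists>\<Psi>. rigid_analytic_trivialization av q s th r A \<Psi>"
  shows "uniformizable av q s th r A"
proof -
  interpret drinfeld av p q s th r A
    by unfold_locales (use assms(1,3) in auto)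
  obtain \<Psi> where \<Psi>: "rigid_analytic_trivialization av q s th r A \<Psi>" using assms(5) by blast
  show ?thesis unfolding uniformizable_def
  proof (intro allI impI)
    fix f assume f: "tate av s f"
    have Mf: "mcoeff (Mps f) = f" by (rule mcoeff_Mps_tate[OF f])
    obtain g where g: "zconv g" "phi (g $ 0) = Mps f" "\<And>n. phi (g $ Suc n) = g $ n"
      using division_tower_of_trivialization[OF assms(2,4) \<Psi>, of "Mps f"] f Mf by auto
    \<comment> \<open>The tower must start at f itself, whereas the z-coefficients start at a
      preimage of f under phi_theta; hence the shift by one.\<close>
    define G where "G = (\<lambda>n. case n of 0 \<Rightarrow> Mps f | Suc k \<Rightarrow> g $ k)"
    have "\<exists>y. tate av s (mcoeff y) \<and> exp_tends y (G 0)"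
    proof (rule exp_surj_of_division_tower)
      show "tate av s (mcoeff (G n))" for n
        using g(1) f by (simp add: G_def zconv_def Mf split: nat.split)
      show "phi (G (Suc n)) = G n" for n
        using g(2,3) by (simp add: G_def split: nat.split)
      fix e :: real assume "e > 0"
      then obtain n where "norm_le av e (g $ n)" using g(1) unfolding zconv_def by blast
      thus "\<exists>n. norm_le av e (G n)" by (intro exI[of _ "Suc n"]) (simp add: G_def)
    qed
    then obtain y where "tate av s (mcoeff y)" "exp_tends y (Mps f)" by (auto simp: G_def)
    thus "\<exists>h. tate av s h \<and> exp_converges_to av q (exp_coeffs av q s th r A) h f"
      using exp_tends_converges[of y "Mps f"] Mf by auto
  qed
qed

end
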